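(* Let $X \subset \mathbb{R}^n$ be a semi-algebraic set and let $f_1, \ldots, f_r \colon X \rightarrow \mathbb{R}$ be continuous semi-algebraic functions. For any continuous selection $f\in\mathcal{C}(f_1,\ldots,f_r,X)$ the following hold: (i) the set of local minimizers of $f$, the set of isolated local minimizers of $f$, and the set of strictly local minimizers of $f$ are semi-algebraic; (ii) the set of isolated local minimizers of $f$ coincides with the set of strictly local minimizers of $f$, and both are finite.
   Context: A subset of $\mathbb{R}^n$ is semi-algebraic if it is a finite union of sets of the form $\{x : p_1(x)=\cdots=p_k(x)=0,\ p_{k+1}(x)>0,\ldots,p_m(x)>0\}$ with real polynomials $p_i$; a function on a semi-algebraic set is semi-algebraic if its graph is semi-algebraic. A function $f\colon X\to\mathbb{R}$ is a continuous selection of $\{f_1,\ldots,f_r\}$ if $f$ is continuous and $f(x)\in\{f_1(x),\ldots,f_r(x)\}$ for all $x\in X$; $\mathcal{C}(f_1,\ldots,f_r,X)$ is the set of all of these. A point $\bar x\in X$ is a local minimizer of $f$ if there is $\delta>0$ with $f(y)\ge f(\bar x)$ for all $y\in X$ with $0<\|y-\bar x\|<\delta$; a strictly local minimizer if there is $\delta>0$ with $f(y)>f(\bar x)$ for all such $y$; an isolated local minimizer if it is a local minimizer and some neighborhood of $\bar x$ contains no other local minimizer of $f$. *)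

theory Defs
  imports "HOL-Analysis.Analysis"
begin

text \<open>
  Real polynomials enter through the library's \<^const>\<open>real_polynomial_function\<close>; on a
  finite-dimensional space these are exactly the functions given by real polynomials in the
  coordinates.  Stating the notion for an arbitrary Euclidean space lets it apply both to subsets
  of \<^typ>\<open>real ^ 'n\<close> and to graphs, which live in \<^typ>\<open>(real ^ 'n) \<times> real\<close>.
\<close>

definition basic_semialgebraic :: "'a::euclidean_space set \<Rightarrow> bool" where
  "basic_semialgebraic S \<longleftrightarrow>
     (\<exists>(p :: nat \<Rightarrow> 'a \<Rightarrow> real) k m. k \<le> m \<and>
        (\<forall>i\<in>{1..m}. real_polynomial_function (p i)) \<and>
        S = {x. (\<forall>i\<in>{1..k}. p i x = 0) \<and> (\<forall>i\<in>{k+1..m}. p i x > 0)})"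

definition semialgebraic :: "'a::euclidean_space set \<Rightarrow> bool" where
  "semialgebraic S \<longleftrightarrow>
     (\<exists>\<S>. finite \<S> \<and> (\<forall>A\<in>\<S>. basic_semialgebraic A) \<and> S = \<Union>\<S>)"

text \<open>
  Functions on \<open>X\<close> are represented by total functions, of which only the values on \<open>X\<close> matter.
\<close>

definition semialgebraic_fun_on :: "'a::euclidean_space set \<Rightarrow> ('a \<Rightarrow> real) \<Rightarrow> bool" where
  "semialgebraic_fun_on X f \<longleftrightarrow> semialgebraic X \<and> semialgebraic {(x, f x) | x. x \<in> X}"

definition continuous_selections ::
    "(nat \<Rightarrow> 'a::euclidean_space \<Rightarrow> real) \<Rightarrow> nat \<Rightarrow> 'a set \<Rightarrow> ('a \<Rightarrow> real) set" where
  "continuous_selections f r X =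
     {g. continuous_on X g \<and> (\<forall>x\<in>X. g x \<in> {f i x | i. i \<in> {1..r}})}"

definition local_minimizer :: "'a::euclidean_space set \<Rightarrow> ('a \<Rightarrow> real) \<Rightarrow> 'a \<Rightarrow> bool" where
  "local_minimizer X f x \<longleftrightarrow> x \<in> X \<and>
     (\<exists>\<delta>>0. \<forall>y\<in>X. 0 < norm (y - x) \<and> norm (y - x) < \<delta> \<longrightarrow> f y \<ge> f x)"

definition strictly_local_minimizer :: "'a::euclidean_space set \<Rightarrow> ('a \<Rightarrow> real) \<Rightarrow> 'a \<Rightarrow> bool" where
  "strictly_local_minimizer X f x \<longleftrightarrow> x \<in> X \<and>
     (\<exists>\<delta>>0. \<forall>y\<in>X. 0 < norm (y - x) \<and> norm (y - x) < \<delta> \<longrightarrow> f y > f x)"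

definition isolated_local_minimizer :: "'a::euclidean_space set \<Rightarrow> ('a \<Rightarrow> real) \<Rightarrow> 'a \<Rightarrow> bool" where
  "isolated_local_minimizer X f x \<longleftrightarrow> local_minimizer X f x \<and>
     (\<exists>U. open U \<and> x \<in> U \<and> (\<forall>y\<in>U. local_minimizer X f y \<longrightarrow> y = x))"

end

theory Submission
  imports Defs "HOL-Computational_Algebra.Fundamental_Theorem_Algebra"
begin

text \<open>
  A set is semialgebraic iff membership in it depends only on the signs of finitely many polynomials.
  Two facts carry the proof.  Quantifier elimination: the sign vectors realised by a finite family
  \<open>P(x, t)\<close> as \<open>t\<close> varies depend only on the signs of finitely many polynomials in \<open>x\<close>.  Connectedness:
  every finite set of polynomials extends to one all of whose sign cells are connected.  Both rest on
  Thom's lemma, which says that a sign condition on a family of univariate polynomials closed under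
  differentiation defines a convex set.

  On a connected cell on which the coincidences \<open>fs i = fs j\<close> do not change, a continuous selection
  equals one fixed \<open>fs i\<close>; hence \<open>f\<close> is semialgebraic and so are its local minimizers.  By second
  countability \<open>f\<close> has only countably many local minimum values and strict local minimizers, so these
  semialgebraic sets are finite.  Since the local minimum values are finite in number and \<open>f\<close> is
  continuous, local minimizers close to a strict one share its value and therefore coincide with it.
\<close>

section \<open>Thom's lemma\<close>

text \<open>The selection is not assumed semialgebraic, so its switching between the
  \<open>fs i\<close> can be controlled only by continuity. On a sign cell with several components
  it could follow a different \<open>fs i\<close> on each of them; this is why the cells have to be
  connected. To see that a cell is connected, one must follow a point of it while the remaining
  coordinates vary, and for this the sign vectors realised over the base must not change. Hence
  quantifier elimination comes before connectedness. Quantifier elimination compares two parameters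
  directly and manipulates no formulas. A member of highest degree has, at a root of another member,
  the sign of a pseudo-remainder of smaller degree, up to a power of a leading coefficient. Between
  consecutive roots it is monotone, because its derivative belongs to the family, so its signs there
  follow from those at the roots and from its unboundedness beyond the last one.\<close>

lemma poly_MVT_segment:
  fixes p :: "real poly"
  shows "\<exists>c\<in>closed_segment a b. poly p b - poly p a = (b - a) * poly (pderiv p) c"
proof (cases a b rule: linorder_cases)
  case less
  then show ?thesis
    using poly_MVT[OF less, of p] by (auto simp: closed_segment_eq_real_ivl)
next
  case greater
  then obtain c where "b < c" "c < a" "poly p a - poly p b = (a - b) * poly (pderiv p) c"
    using poly_MVT[OF greater, of p] by blast
  then have "c \<in> closed_segment a b" "poly p b - poly p a = (b - a) * poly (pderiv p) c"
    by (auto simp: closed_segment_eq_real_ivl algebra_simps)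
  then show ?thesis by blast
qed auto

text \<open>A segment does not record which endpoint is larger and may be degenerate. Later the
  endpoints come from a transfer between parameters, and their order is not known in
  advance.\<close>

lemma poly_IVT_segment:
  fixes p :: "real poly"
  assumes "poly p a * poly p b \<le> 0"
  shows "\<exists>c\<in>closed_segment a b. poly p c = 0"
proof (cases "poly p a = 0 \<or> poly p b = 0")
  case False
  then have neg: "poly p a * poly p b < 0"
    using assms by (simp add: less_le)
  then have "a \<noteq> b"
    by (auto simp: mult_less_0_iff)
  then consider "a < b" | "b < a" by linarith
  then show ?thesis
  proof cases
    case 1
    then show ?thesis
      using poly_IVT[OF 1 neg] by (auto simp: closed_segment_eq_real_ivl)
  next
    case 2
    then show ?thesis
      using poly_IVT[OF 2, of p] neg by (auto simp: closed_segment_eq_real_ivl mult.commute)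
  qed
qed auto

text \<open>By induction the derivative does not take opposite signs on the segment, so the mean
  value theorem on both sides of \<open>z\<close> places \<open>poly h z\<close> between the two end
  values, which do not have opposite signs either. Asking for a nonnegative product rather than
  equal signs admits an endpoint where some members vanish, so a segment may end on the boundary of
  a sign cell.\<close>

lemma thom_segment:
  fixes D :: "real poly set"
  assumes closed: "\<And>h. h \<in> D \<Longrightarrow> pderiv h \<in> D"
    and compat: "\<And>h. h \<in> D \<Longrightarrow> poly h a * poly h b \<ge> 0"
  shows "h \<in> D \<Longrightarrow> z \<in> closed_segment a b \<Longrightarrow> sgn (poly h z) \<in> {sgn (poly h a), sgn (poly h b)}"
proof (induction "degree h" arbitrary: h z rule: less_induct)
  case less
  show ?case
  proof (cases "degree h = 0")
    case True
    then obtain c where "h = [:c:]" by (metis degree_eq_zeroE)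
    then show ?thesis by simp
  next
    case False
    have deg: "degree (pderiv h) < degree h"
      using False by (simp add: degree_pderiv)
    have IH: "sgn (poly (pderiv h) w) \<in> {sgn (poly (pderiv h) a), sgn (poly (pderiv h) b)}"
      if "w \<in> closed_segment a b" for w
      using less.hyps[OF deg closed[OF less.prems(1)] that] .
    obtain c1 where c1: "c1 \<in> closed_segment a z" "poly h z - poly h a = (z - a) * poly (pderiv h) c1"
      using poly_MVT_segment by blast
    obtain c2 where c2: "c2 \<in> closed_segment z b" "poly h b - poly h z = (b - z) * poly (pderiv h) c2"
      using poly_MVT_segment by blast
    have sub: "closed_segment a z \<subseteq> closed_segment a b" "closed_segment z b \<subseteq> closed_segment a b"
      using less.prems(2) by (simp_all add: subset_closed_segment)
    have "poly (pderiv h) a * poly (pderiv h) b \<ge> 0"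
      using compat closed less.prems(1) by blast
    then have "poly (pderiv h) c1 * poly (pderiv h) c2 \<ge> 0"
      using IH[of c1] IH[of c2] c1(1) c2(1) sub
      by (auto simp: sgn_real_def zero_le_mult_iff split: if_splits)
    moreover have "(z - a) * (b - z) \<ge> 0"
      using less.prems(2) by (auto simp: closed_segment_eq_real_ivl zero_le_mult_iff split: if_splits)
    ultimately have "0 \<le> ((z - a) * (b - z)) * (poly (pderiv h) c1 * poly (pderiv h) c2)"
      by simp
    also have "\<dots> = (poly h z - poly h a) * (poly h b - poly h z)"
      using c1(2) c2(2) by simp
    finally have "(poly h z - poly h a) * (poly h b - poly h z) \<ge> 0" .
    moreover have "poly h a * poly h b \<ge> 0"
      using compat less.prems(1) by blast
    ultimately show ?thesis
      by (auto simp: sgn_real_def zero_le_mult_iff split: if_splits)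
  qed
qed

section \<open>Growth, zeros and simple roots of univariate polynomials\<close>

lemma poly_unbounded_direction:
  fixes p :: "real poly" and e :: real
  assumes "degree p > 0" and "e = 1 \<or> e = - 1"
  shows "\<exists>z. e * (z - a) > 0 \<and> \<bar>poly p z\<bar> > M"
proof -
  obtain c q where p: "p = pCons c q" by (cases p)
  then have "q \<noteq> 0" using assms(1) by auto
  then obtain r where r: "\<And>z. r \<le> norm z \<Longrightarrow> M + 1 \<le> norm (poly (pCons c q) z)"
    using poly_infinity[of q "M + 1" c] by blast
  define z where "z = e * (\<bar>r\<bar> + \<bar>a\<bar> + 1)"
  have "r \<le> norm z" "e * (z - a) > 0"
    using assms(2) by (auto simp: z_def)
  then show ?thesis using r[of z] p by (intro exI[of _ z]) auto
qed

lemma poly_eq_0_if_zero_on_segment: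
  fixes p :: "real poly"
  assumes "\<And>z. z \<in> closed_segment a b \<Longrightarrow> poly p z = 0" "a \<noteq> b"
  shows "p = 0"
proof (rule ccontr)
  assume "p \<noteq> 0"
  then have "finite {z. poly p z = 0}" by (rule poly_roots_finite)
  moreover have "closed_segment a b \<subseteq> {z. poly p z = 0}" using assms(1) by auto
  ultimately have "finite (closed_segment a b)" by (rule finite_subset[rotated])
  then show False using assms(2) by (simp add: finite_closed_segment)
qed

lemma simple_root_sign_change:
  fixes p :: "real poly"
  assumes "poly p t = 0" "poly (pderiv p) t \<noteq> 0" "d > 0"
  shows "\<exists>h. 0 < h \<and> h < d \<and> poly p (t - h) * poly p (t + h) < 0"
proof -
  have "isCont (poly (pderiv p)) t" by simp
  then obtain e where e: "e > 0" "\<And>s. dist s t < e \<Longrightarrow> poly (pderiv p) s * poly (pderiv p) t > 0"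
  proof -
    have "((\<lambda>s. poly (pderiv p) s * poly (pderiv p) t) \<longlongrightarrow> poly (pderiv p) t * poly (pderiv p) t) (nhds t)"
      using poly_isCont[of t "pderiv p"] unfolding isCont_def tendsto_at_iff_tendsto_nhds
      by (intro tendsto_mult tendsto_const)
    moreover have "poly (pderiv p) t * poly (pderiv p) t > 0"
      using assms(2) by (metis not_real_square_gt_zero)
    ultimately have "\<forall>\<^sub>F s in nhds t. poly (pderiv p) s * poly (pderiv p) t > 0"
      by (rule order_tendstoD(1))
    then show ?thesis using that unfolding eventually_nhds_metric by blast
  qed
  define h where "h = min d e / 2"
  have h: "0 < h" "h < d" "h < e" using assms(3) e(1) by (auto simp: h_def min_def)
  obtain c where c: "c \<in> closed_segment t (t + h)" "poly p (t + h) - poly p t = (t + h - t) * poly (pderiv p) c"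
    using poly_MVT_segment by blast
  obtain c' where c': "c' \<in> closed_segment (t - h) t" "poly p t - poly p (t - h) = (t - (t - h)) * poly (pderiv p) c'"
    using poly_MVT_segment by blast
  have "dist c t < e" "dist c' t < e"
    using c(1) c'(1) h by (auto simp: dist_real_def closed_segment_eq_real_ivl)
  then have "poly (pderiv p) c * poly (pderiv p) t > 0" "poly (pderiv p) c' * poly (pderiv p) t > 0"
    using e(2) by auto
  then have "poly (pderiv p) c * poly (pderiv p) c' > 0" by (auto simp: zero_less_mult_iff)
  then have "(h * h) * (poly (pderiv p) c * poly (pderiv p) c') > 0" using h(1) by simp
  moreover have "poly p (t - h) * poly p (t + h) = - ((h * h) * (poly (pderiv p) c * poly (pderiv p) c'))"
  proof -
    have "poly p (t + h) = h * poly (pderiv p) c" "poly p (t - h) = - (h * poly (pderiv p) c')"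
      using c(2) c'(2) assms(1) by simp_all
    then show ?thesis by simp
  qed
  ultimately show ?thesis using h by (intro exI[of _ h]) auto
qed

lemma sgn_tendsto_nonzero:
  fixes f :: "'b \<Rightarrow> real"
  assumes "(f \<longlongrightarrow> l) A" "l \<noteq> 0"
  shows "\<forall>\<^sub>F x in A. sgn (f x) = sgn l"
proof (cases "l > 0")
  case True
  show ?thesis using order_tendstoD(1)[OF assms(1) True] True by (auto elim: eventually_mono)
next
  case False
  then have neg: "l < 0" using assms(2) by simp
  show ?thesis using order_tendstoD(2)[OF assms(1) neg] neg by (auto elim: eventually_mono)
qed

text \<open>A member of \<open>F\<close> is a polynomial depending on a parameter, so sign vectors
  can be compared across parameters, even where two members coincide as polynomials.\<close>

definition poly_signs :: "('x \<Rightarrow> real poly) set \<Rightarrow> 'x \<Rightarrow> real \<Rightarrow> 'x \<Rightarrow> real \<Rightarrow> bool" where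
  "poly_signs F x t x' t' \<longleftrightarrow> (\<forall>P\<in>F. sgn (poly (P x) t) = sgn (poly (P x') t'))"

definition pderiv_closed :: "('x \<Rightarrow> real poly) set \<Rightarrow> bool" where
  "pderiv_closed F \<longleftrightarrow> (\<forall>P\<in>F. (\<lambda>x. pderiv (P x)) \<in> F)"

lemma thom_family:
  assumes "pderiv_closed F"
    and "\<And>P. P \<in> F \<Longrightarrow> poly (P x) a * poly (P x) b \<ge> 0"
    and "P \<in> F" "z \<in> closed_segment a b"
  shows "sgn (poly (P x) z) \<in> {sgn (poly (P x) a), sgn (poly (P x) b)}"
  by (rule thom_segment[where D = "(\<lambda>P. P x) ` F"])
     (use assms in \<open>auto simp: pderiv_closed_def\<close>)

lemma poly_signs_convex:
  assumes "pderiv_closed F" "poly_signs F x t x' a" "poly_signs F x t x' b"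
    and "z \<in> closed_segment a b"
  shows "poly_signs F x t x' z"
  unfolding poly_signs_def
proof
  fix P assume P: "P \<in> F"
  have eq: "sgn (poly (P x') a) = sgn (poly (P x') b)" if "P \<in> F" for P
    using assms(2,3) that by (auto simp: poly_signs_def)
  have "poly (P x') a * poly (P x') b \<ge> 0" if "P \<in> F" for P
    using eq[OF that] by (auto simp: sgn_real_def zero_le_mult_iff split: if_splits)
  then have "sgn (poly (P x') z) \<in> {sgn (poly (P x') a), sgn (poly (P x') b)}"
    by (intro thom_family[OF assms(1) _ P assms(4)]) auto
  then show "sgn (poly (P x) t) = sgn (poly (P x') z)"
    using assms(2,3) P by (auto simp: poly_signs_def)
qed

text \<open>By the mean value theorem \<open>g\<close> reaches 0 at \<open>b\<close> with a slope of
  nonzero sign. Thom's lemma allows only the signs of the derivative at the two ends, and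
  compatibility leaves a single nonzero choice, the same for \<open>x\<close> and \<open>x'\<close>.
  Hence the side on which the root lies can be read off from the sign vectors.\<close>

lemma sgn_displacement_of_root:
  assumes "pderiv_closed F"
    and "poly_signs F x y x' y'" "poly_signs F x b x' b'"
    and "\<And>P. P \<in> F \<Longrightarrow> poly (P x) y * poly (P x) b \<ge> 0"
    and g: "g \<in> F" "poly (g x) b = 0" "poly (g x) y \<noteq> 0"
  shows "sgn (b - y) = sgn (b' - y')"
proof -
  define dg where "dg = (\<lambda>x. pderiv (g x))"
  have dg: "dg \<in> F" using assms(1) g(1) by (auto simp: pderiv_closed_def dg_def)
  have sg: "sgn (poly (P x) y) = sgn (poly (P x') y')" "sgn (poly (P x) b) = sgn (poly (P x') b')"
    if "P \<in> F" for P
    using assms(2,3) that by (auto simp: poly_signs_def)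
  have compat': "poly (P x') y' * poly (P x') b' \<ge> 0" if "P \<in> F" for P
    using sg[OF that] assms(4)[OF that]
    by (auto simp: sgn_real_def zero_le_mult_iff split: if_splits)
  obtain c where c: "c \<in> closed_segment y b" "poly (g x) b - poly (g x) y = (b - y) * poly (dg x) c"
    using poly_MVT_segment unfolding dg_def by blast
  obtain c' where c': "c' \<in> closed_segment y' b'"
      "poly (g x') b' - poly (g x') y' = (b' - y') * poly (dg x') c'"
    using poly_MVT_segment unfolding dg_def by blast
  have g': "poly (g x') b' = 0" using sg(2)[OF g(1)] g(2) by (auto simp: sgn_real_def split: if_splits)
  have e1: "- sgn (poly (g x) y) = sgn (b - y) * sgn (poly (dg x) c)"
    using c(2) g(2) by (metis sgn_mult diff_0 sgn_minus)
  have e2: "- sgn (poly (g x) y) = sgn (b' - y') * sgn (poly (dg x') c')"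
    using c'(2) g' sg(1)[OF g(1)] by (metis sgn_mult diff_0 sgn_minus)
  have m1: "sgn (poly (dg x) c) \<in> {sgn (poly (dg x) y), sgn (poly (dg x) b)}"
    using thom_family[OF assms(1,4) dg c(1)] .
  have m2: "sgn (poly (dg x') c') \<in> {sgn (poly (dg x') y'), sgn (poly (dg x') b')}"
    using thom_family[OF assms(1) compat' dg c'(1)] .
  have nz: "sgn (poly (dg x) c) \<noteq> 0" "sgn (poly (dg x') c') \<noteq> 0"
    using e1 e2 g(3) by (metis mult_zero_right neg_equal_0_iff_equal sgn_eq_0_iff)+
  have "0 \<le> sgn (poly (dg x) y) * sgn (poly (dg x) b)"
    using assms(4)[OF dg] by (metis sgn_mult sgn_pos sgn_0 less_le zero_le_one)
  moreover have "s = s'" if "0 \<le> p * q" "s \<in> {p, q}" "s' \<in> {p, q}" "s \<noteq> 0" "s' \<noteq> 0"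
    "p \<in> {-1,0,1}" "q \<in> {-1,0,1}" for p q s s' :: real
    using that by auto
  ultimately have "sgn (poly (dg x) c) = sgn (poly (dg x') c')"
    using m1 m2 nz sg[OF dg] by (smt (verit) insertCI sgn_real_def)
  then show ?thesis using e1 e2 nz by (metis mult_right_cancel)
qed

section \<open>Transfer of signs between two parameters\<close>

definition nonzero_root :: "('x \<Rightarrow> real poly) set \<Rightarrow> 'x \<Rightarrow> real \<Rightarrow> bool" where
  "nonzero_root F x t \<longleftrightarrow> (\<exists>P\<in>F. P x \<noteq> 0 \<and> poly (P x) t = 0)"

text \<open>The sign of \<open>f\<close> has to agree only at roots of the family, since only there
  can \<open>f\<close> be replaced by a remainder of smaller degree.\<close>

definition root_transfer :: "('x \<Rightarrow> real poly) set \<Rightarrow> ('x \<Rightarrow> real poly) \<Rightarrow> 'x \<Rightarrow> 'x \<Rightarrow> bool" where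
  "root_transfer F f x x' \<longleftrightarrow>
     (\<forall>t. \<exists>t'. poly_signs F x t x' t' \<and> (nonzero_root F x t \<longrightarrow> sgn (poly (f x) t) = sgn (poly (f x') t')))"

text \<open>Equal coefficient signs force equal degrees and simultaneous identical vanishing.
  Otherwise the counterpart of a root could be a zero of a polynomial that vanishes
  identically.\<close>

definition same_coeff_signs :: "('x \<Rightarrow> real poly) set \<Rightarrow> 'x \<Rightarrow> 'x \<Rightarrow> bool" where
  "same_coeff_signs F x x' \<longleftrightarrow> (\<forall>P\<in>F. \<forall>i. sgn (coeff (P x) i) = sgn (coeff (P x') i))"

lemma sgn_eq_imp_zero_iff: "sgn (a::real) = sgn b \<Longrightarrow> a = 0 \<longleftrightarrow> b = 0"
  by (auto simp: sgn_real_def split: if_splits)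

lemma same_coeff_signs_zero_iff:
  assumes "same_coeff_signs F x x'" "P \<in> F"
  shows "P x = 0 \<longleftrightarrow> P x' = 0"
proof -
  have "coeff (P x) i = 0 \<longleftrightarrow> coeff (P x') i = 0" for i
    using assms by (intro sgn_eq_imp_zero_iff) (auto simp: same_coeff_signs_def)
  then show ?thesis by (simp add: poly_eq_iff)
qed

lemma same_coeff_signs_degree:
  assumes "same_coeff_signs F x x'" "P \<in> F"
  shows "degree (P x) = degree (P x')"
proof -
  have "coeff (P x) i = 0 \<longleftrightarrow> coeff (P x') i = 0" for i
    using assms by (intro sgn_eq_imp_zero_iff) (auto simp: same_coeff_signs_def)
  then show ?thesis by (simp add: degree_def)
qed

lemma poly_signs_near:
  assumes "finite F" "\<not> nonzero_root F x t"
  shows "\<forall>\<^sub>F s in nhds t. poly_signs F x t x s"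
  unfolding poly_signs_def
proof (rule eventually_ball_finite[OF assms(1)], rule ballI)
  fix P assume P: "P \<in> F"
  show "\<forall>\<^sub>F s in nhds t. sgn (poly (P x) t) = sgn (poly (P x) s)"
  proof (cases "P x = 0")
    case False
    then have nz: "poly (P x) t \<noteq> 0" using assms(2) P by (auto simp: nonzero_root_def)
    have "(poly (P x) \<longlongrightarrow> poly (P x) t) (nhds t)"
      using tendsto_at_iff_tendsto_nhds poly_isCont isCont_def by blast
    from sgn_tendsto_nonzero[OF this nz] show ?thesis by (simp add: eq_commute)
  qed auto
qed

text \<open>The far end \<open>b\<close> may be a root, where signs may drop to 0: up to
  \<open>b\<close> only the product is controlled, before \<open>b\<close> the signs are equal. The
  product is the compatibility that \<open>thom_family\<close> asks for.\<close>

lemma sgn_until_root: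
  assumes noroot: "\<And>z. z \<in> closed_segment a b \<Longrightarrow> z \<noteq> b \<Longrightarrow> \<not> nonzero_root F x z"
    and P: "P \<in> F" and z: "z \<in> closed_segment a b" and ab: "a \<noteq> b"
  shows "poly (P x) a * poly (P x) z \<ge> 0" "z \<noteq> b \<Longrightarrow> sgn (poly (P x) z) = sgn (poly (P x) a)"
proof -
  have seg: "closed_segment a z \<subseteq> closed_segment a b" using z by (simp add: subset_closed_segment)
  have nz: "poly (P x) w \<noteq> 0" if "P x \<noteq> 0" "w \<in> closed_segment a b" "w \<noteq> b" for w
    using noroot[OF that(2,3)] that(1) P by (auto simp: nonzero_root_def)
  show 1: "poly (P x) a * poly (P x) z \<ge> 0"
  proof (rule ccontr)
    assume "\<not> ?thesis"
    then have neg: "poly (P x) a * poly (P x) z < 0" by simp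
    then have "poly (P x) a * poly (P x) z \<le> 0" by simp
    then obtain c where c: "c \<in> closed_segment a z" "poly (P x) c = 0"
      using poly_IVT_segment by blast
    have "P x \<noteq> 0" using neg by auto
    have "c \<noteq> z" "z \<noteq> a" using c(2) neg by (auto simp: mult_less_0_iff)
    then have "c \<noteq> b" using c(1) z by (auto simp: closed_segment_eq_real_ivl split: if_splits)
    then show False using nz[OF \<open>P x \<noteq> 0\<close>, of c] c seg by auto
  qed
  assume "z \<noteq> b"
  show "sgn (poly (P x) z) = sgn (poly (P x) a)"
  proof (cases "P x = 0")
    case False
    then show ?thesis using nz[OF False z \<open>z \<noteq> b\<close>] nz[OF False, of a] 1 ab
      by (auto simp: sgn_real_def zero_le_mult_iff split: if_splits)
  qed auto
qed

text \<open>The factor \<open>e\<close> stands for a direction, so the left and the right side of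
  \<open>y\<close> are treated at once. A nearest root exists because the nonzero members have
  finitely many roots in all.\<close>

lemma exists_first_root:
  fixes y e :: real
  assumes fin: "finite F" and e: "e = 1 \<or> e = - 1"
  shows "(\<forall>z. e * (z - y) > 0 \<longrightarrow> \<not> nonzero_root F x z) \<or>
    (\<exists>b. e * (b - y) > 0 \<and> nonzero_root F x b \<and>
      (\<forall>z\<in>closed_segment y b. z \<noteq> y \<longrightarrow> z \<noteq> b \<longrightarrow> \<not> nonzero_root F x z))"
proof -
  let ?Z = "{z. nonzero_root F x z \<and> e * (z - y) > 0}"
  have "?Z \<subseteq> (\<Union>P\<in>{P\<in>F. P x \<noteq> 0}. {z. poly (P x) z = 0})" by (auto simp: nonzero_root_def)
  then have finZ: "finite ?Z" by (rule finite_subset) (use fin in \<open>auto intro: poly_roots_finite\<close>)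
  show ?thesis
  proof (cases "?Z = {}")
    case False
    obtain b where b: "b \<in> ?Z" "\<And>z. z \<in> ?Z \<Longrightarrow> e * (b - y) \<le> e * (z - y)"
      using finite_has_minimal[of "(\<lambda>z. e * (z - y)) ` ?Z"] finZ False
      by (smt (verit) arg_min_least arg_min_if_finite(1))
    have "\<not> nonzero_root F x z" if "z \<in> closed_segment y b" "z \<noteq> y" "z \<noteq> b" for z
    proof
      assume "nonzero_root F x z"
      moreover have "e * (z - y) > 0" "e * (z - y) < e * (b - y)"
        using e b(1) that by (auto simp: closed_segment_eq_real_ivl split: if_splits)
      ultimately show False using b(2)[of z] by auto
    qed
    then show ?thesis using b(1) by blast
  qed auto
qed

text \<open>On the cell of \<open>y'\<close> the polynomial \<open>f x'\<close> is strictly monotone, so its sign can be forced by moving in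
  the direction \<open>e\<close> in which \<open>s * f\<close> increases: either \<open>f x'\<close> is unbounded there, or the cell ends at a
  root \<open>b'\<close>, whose counterpart \<open>b\<close> at \<open>x\<close> lies on the same side of \<open>y\<close> and pins down the sign of \<open>f\<close>.\<close>

lemma transfer_nonzero_sign:
  assumes fin: "finite F" and clos: "pderiv_closed F" and fF: "(\<lambda>x. pderiv (f x)) \<in> F"
    and coef: "same_coeff_signs (insert f F) x x'"
    and tr: "root_transfer F f x x'" and tr': "root_transfer F f x' x"
    and nr: "\<not> nonzero_root F x y" and nz: "poly (f x) y \<noteq> 0"
  shows "\<exists>t'. poly_signs (insert f F) x y x' t'"
proof -
  obtain y' where y': "poly_signs F x y x' y'" using tr unfolding root_transfer_def by blast
  define df where "df = (\<lambda>x. pderiv (f x))"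
  define s where "s = sgn (poly (f x) y)"
  have s: "s = 1 \<or> s = -1" "s * poly (f x) y > 0"
    using nz by (auto simp: s_def sgn_real_def)
  have coefF: "same_coeff_signs F x x'" using coef by (auto simp: same_coeff_signs_def)
  have nr': "\<not> nonzero_root F x' y'"
    using nr y' same_coeff_signs_zero_iff[OF coefF] sgn_eq_imp_zero_iff
    unfolding nonzero_root_def poly_signs_def by metis
  have goal: ?thesis if "poly_signs F x y x' z" "s * poly (f x') z > 0" for z
    using that s by (intro exI[of _ z]) (auto simp: poly_signs_def s_def sgn_real_def split: if_splits)
  have sgn_df: "sgn (poly (df x) y) = sgn (poly (df x') y')"
    using y' fF by (auto simp: poly_signs_def df_def)
  show ?thesis
  proof (cases "df x = 0")
    case True
    then have "degree (f x) = 0" by (simp add: df_def pderiv_eq_0_iff)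
    moreover then have "degree (f x') = 0" using same_coeff_signs_degree[OF coef, of f] by simp
    ultimately have "sgn (poly (f x) y) = sgn (poly (f x') y')"
      using coef by (auto elim!: degree_eq_zeroE simp: same_coeff_signs_def)
        (metis coeff_pCons_0)
    then show ?thesis using y' by (auto simp: poly_signs_def)
  next
    case False
    have dfnz: "poly (df x) y \<noteq> 0" using nr False fF by (auto simp: nonzero_root_def df_def)
    define e where "e = s * sgn (poly (df x) y)"
    have e: "e = 1 \<or> e = -1" using s dfnz by (auto simp: e_def sgn_real_def)
    have e_df: "e * s * poly (df x) y > 0" "e * s * poly (df x') y' > 0"
      using s(1) dfnz sgn_df by (auto simp: e_def sgn_real_def split: if_splits)
    show ?thesis
      using exists_first_root[OF fin e, of y' x']
    proof (elim disjE exE conjE)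
      assume noroot: "\<forall>z. e * (z - y') > 0 \<longrightarrow> \<not> nonzero_root F x' z"
      have "degree (f x') > 0"
      proof (rule ccontr)
        assume "\<not> ?thesis"
        then have "df x' = 0" by (simp add: df_def pderiv_eq_0_iff)
        then show False using e_df by simp
      qed
      \<comment> \<open>\<open>s * f\<close> increases from \<open>y'\<close> to \<open>z\<close>.
        If it were still nonpositive at \<open>z\<close>, its absolute value would have decreased;
        so exceeding the old absolute value forces the sign \<open>s\<close>.\<close>
      then obtain z where z: "e * (z - y') > 0" "\<bar>poly (f x') z\<bar> > \<bar>poly (f x') y'\<bar>"
        using poly_unbounded_direction[OF _ e] by blast
      have nrz: "\<not> nonzero_root F x' w" if "w \<in> closed_segment y' z" for w
      proof (cases "w = y'")
        case False
        then have "e * (w - y') > 0"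
          using that z(1) e by (auto simp: closed_segment_eq_real_ivl split: if_splits)
        then show ?thesis using noroot by blast
      qed (use nr' in simp)
      have "y' \<noteq> z" using z by auto
      have same: "sgn (poly (P x') w) = sgn (poly (P x') y')" if "w \<in> closed_segment y' z" "P \<in> F" for w P
      proof (cases "w = z")
        case False
        then show ?thesis using sgn_until_root(2)[OF nrz that(2,1) \<open>y' \<noteq> z\<close>] by blast
      next
        case True
        show ?thesis
        proof (cases "P x' = 0")
          case nzP: False
          then have "poly (P x') z \<noteq> 0" "poly (P x') y' \<noteq> 0"
            using nrz[of z] nrz[of y'] that(2) by (auto simp: nonzero_root_def)
          then show ?thesis
            using sgn_until_root(1)[OF nrz that(2,1) \<open>y' \<noteq> z\<close>] True
            by (auto simp: sgn_real_def zero_le_mult_iff split: if_splits)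
        qed auto
      qed
      obtain c where c: "c \<in> closed_segment y' z" "poly (f x') z - poly (f x') y' = (z - y') * poly (df x') c"
        using poly_MVT_segment unfolding df_def by blast
      have "sgn (poly (df x') c) = sgn (poly (df x') y')"
        using same[OF c(1)] fF by (simp add: df_def)
      then have "(e * (z - y')) * (e * s * poly (df x') c) > 0"
        using z(1) e_df(2) e s(1) by (auto simp: sgn_real_def mult_less_0_iff zero_less_mult_iff split: if_splits)
      moreover have "(e * (z - y')) * (e * s * poly (df x') c) = (e * e) * (s * (poly (f x') z - poly (f x') y'))"
        unfolding c(2) by (simp only: mult_ac)
      ultimately have "s * (poly (f x') z - poly (f x') y') > 0"
        using e by auto
      then have "s * poly (f x') z > 0"
        using z(2) s(1) by (auto simp: algebra_simps abs_if split: if_splits)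
      moreover have "poly_signs F x y x' z"
        using same[of z] y' by (auto simp: poly_signs_def)
      ultimately show ?thesis using goal by blast
    next
      fix b' assume b': "e * (b' - y') > 0" "nonzero_root F x' b'"
        "\<forall>z\<in>closed_segment y' b'. z \<noteq> y' \<longrightarrow> z \<noteq> b' \<longrightarrow> \<not> nonzero_root F x' z"
      have "y' \<noteq> b'" using b' by auto
      have nrz: "\<not> nonzero_root F x' w" if "w \<in> closed_segment y' b'" "w \<noteq> b'" for w
        using that b'(3) nr' by (cases "w = y'") auto
      note until = sgn_until_root[OF nrz _ _ \<open>y' \<noteq> b'\<close>]
      \<comment> \<open>Transfer in the opposite direction: since \<open>b'\<close> is a root, it
        also carries the sign of \<open>f\<close>.\<close>
      obtain b where b: "poly_signs F x' b' x b" "sgn (poly (f x') b') = sgn (poly (f x) b)"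
        using tr' b'(2) unfolding root_transfer_def by blast
      have b2: "poly_signs F x b x' b'" using b(1) by (auto simp: poly_signs_def)
      have compat: "poly (P x) y * poly (P x) b \<ge> 0" if "P \<in> F" for P
      proof -
        have "poly (P x') y' * poly (P x') b' \<ge> 0" using until(1)[where z = b' and P = P] that by auto
        moreover have "sgn (poly (P x) y) = sgn (poly (P x') y')" "sgn (poly (P x) b) = sgn (poly (P x') b')"
          using y' b2 that by (auto simp: poly_signs_def)
        ultimately show ?thesis by (auto simp: sgn_real_def zero_le_mult_iff split: if_splits)
      qed
      obtain g where g: "g \<in> F" "g x' \<noteq> 0" "poly (g x') b' = 0"
        using b'(2) unfolding nonzero_root_def by blast
      have "g x \<noteq> 0" using same_coeff_signs_zero_iff[OF coefF g(1)] g(2) by blast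
      moreover have "poly (g x) b = 0"
        using b2 g sgn_eq_imp_zero_iff by (metis poly_signs_def)
      moreover have "poly (g x) y \<noteq> 0" using nr g(1) \<open>g x \<noteq> 0\<close> by (auto simp: nonzero_root_def)
      ultimately have "sgn (b - y) = sgn (b' - y')"
        using compat by (intro sgn_displacement_of_root[OF clos y' b2 _ g(1)]) auto
      then have dir: "e * (b - y) > 0"
        using b'(1) e by (auto simp: sgn_real_def split: if_splits)
      obtain c where c: "c \<in> closed_segment y b" "poly (f x) b - poly (f x) y = (b - y) * poly (df x) c"
        using poly_MVT_segment unfolding df_def by blast
      have "sgn (poly (df x) c) \<in> {sgn (poly (df x) y), sgn (poly (df x) b)}"
        using thom_family[OF clos compat fF c(1)] by (simp add: df_def)
      then have "e * s * poly (df x) c \<ge> 0"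
        using compat[OF fF] e_df(1) e s(1)
        by (auto simp: df_def sgn_real_def zero_le_mult_iff split: if_splits)
      then have "(e * (b - y)) * (e * s * poly (df x) c) \<ge> 0" using dir by simp
      moreover have "(e * (b - y)) * (e * s * poly (df x) c) = (e * e) * (s * (poly (f x) b - poly (f x) y))"
        unfolding c(2) by (simp only: mult_ac)
      ultimately have "s * (poly (f x) b - poly (f x) y) \<ge> 0"
        using e by auto
      then have "s * poly (f x) b > 0" using s(2) by (simp add: algebra_simps)
      then have fb': "s * poly (f x') b' > 0"
        using b(2) s(1) by (auto simp: sgn_real_def split: if_splits)
      have lim: "((\<lambda>z. s * poly (f x') z) \<longlongrightarrow> s * poly (f x') b') (at b')"
        by (intro tendsto_mult tendsto_const isContD poly_isCont)
      obtain d where d: "d > 0" "\<And>z. z \<noteq> b' \<Longrightarrow> dist z b' < d \<Longrightarrow> s * poly (f x') z > 0"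
        using order_tendstoD(1)[OF lim fb'] unfolding eventually_at by auto
      \<comment> \<open>Some member of \<open>F\<close> vanishes at \<open>b'\<close> but not at
        \<open>y'\<close>, so \<open>b'\<close> lies outside the cell of \<open>y'\<close>. Stepping
        back by less than the distance to \<open>y'\<close> enters the cell again, and by less than
        \<open>d\<close> keeps the sign of \<open>f\<close>.\<close>
      define h where "h = min (d / 2) (\<bar>b' - y'\<bar> / 2)"
      define z where "z = b' - e * h"
      have h: "h > 0" "h < d" "h < \<bar>b' - y'\<bar>"
        using d(1) \<open>y' \<noteq> b'\<close> by (auto simp: h_def min_def)
      have z: "z \<in> closed_segment y' b'" "z \<noteq> b'" "dist z b' < d"
        using h e b'(1) by (auto simp: z_def dist_real_def closed_segment_eq_real_ivl)
      have "poly_signs F x y x' z"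
        using until(2)[OF _ _ _ z(1,2)] y' z by (auto simp: poly_signs_def)
      then show ?thesis using goal d(2)[OF z(2,3)] by blast
    qed
  qed
qed

text \<open>At roots of \<open>F\<close> this is the hypothesis; where \<open>f\<close> does not
  vanish it is the preceding lemma. If \<open>f x\<close> is nonzero but vanishes at
  \<open>t\<close>, then \<open>t\<close> is a simple root inside an \<open>F\<close>-cell, so both
  signs of \<open>f\<close> occur in that cell. Transferring one point for each sign, and using that
  the cell at \<open>x'\<close> is convex, gives a zero of \<open>f x'\<close> in it.\<close>

lemma transfer_insert:
  assumes fin: "finite F" and clos: "pderiv_closed F" and fF: "(\<lambda>x. pderiv (f x)) \<in> F"
    and coef: "same_coeff_signs (insert f F) x x'"
    and tr: "root_transfer F f x x'" and tr': "root_transfer F f x' x"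
  shows "\<exists>t'. poly_signs (insert f F) x t x' t'"
proof (cases "nonzero_root F x t")
  case True
  then show ?thesis using tr unfolding root_transfer_def poly_signs_def by (metis insert_iff)
next
  case nr: False
  note nonzero = transfer_nonzero_sign[OF assms]
  show ?thesis
  proof (cases "poly (f x) t = 0")
    case False
    then show ?thesis using nonzero[OF nr] by blast
  next
    case root: True
    show ?thesis
    proof (cases "f x = 0")
      case True
      then have "f x' = 0" using same_coeff_signs_zero_iff[OF coef, of f] by simp
      then show ?thesis using tr True unfolding root_transfer_def poly_signs_def
        by (metis insert_iff poly_0)
    next
      case False
      define df where "df = (\<lambda>x. pderiv (f x))"
      have "df x \<noteq> 0"
      proof
        assume "df x = 0"
        then have "degree (f x) = 0" by (simp add: df_def pderiv_eq_0_iff)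
        then show False using root False by (metis degree_eq_zeroE poly_const_conv pCons_0_0)
      qed
      then have dfnz: "poly (df x) t \<noteq> 0" using nr fF by (auto simp: nonzero_root_def df_def)
      obtain d where d: "d > 0" "\<And>s. dist s t < d \<Longrightarrow> poly_signs F x t x s"
        using poly_signs_near[OF fin nr] unfolding eventually_nhds_metric by blast
      obtain h where h: "0 < h" "h < d" "poly (f x) (t - h) * poly (f x) (t + h) < 0"
        using simple_root_sign_change[OF root dfnz[unfolded df_def] d(1)] by blast
      define u where "u = t + h"
      define v where "v = t - h"
      have uv: "poly_signs F x t x u" "poly_signs F x t x v"
        using d h by (auto simp: u_def v_def dist_real_def)
      have nr_uv: "\<not> nonzero_root F x u" "\<not> nonzero_root F x v"
        using uv nr sgn_eq_imp_zero_iff unfolding nonzero_root_def poly_signs_def by metis+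
      have prod: "poly (f x) u * poly (f x) v < 0"
        using h(3) by (simp add: u_def v_def mult.commute)
      then have "poly (f x) u \<noteq> 0" "poly (f x) v \<noteq> 0" by auto
      then obtain u' v' where u': "poly_signs (insert f F) x u x' u'" and v': "poly_signs (insert f F) x v x' v'"
        using nonzero nr_uv by meson
      have "poly (f x') u' * poly (f x') v' < 0"
        using u' v' prod by (auto simp: poly_signs_def sgn_real_def mult_less_0_iff split: if_splits)
      then obtain w where w: "w \<in> closed_segment u' v'" "poly (f x') w = 0"
        using poly_IVT_segment[of "f x'" u' v'] by force
      have "poly_signs F x t x' w"
        using u' v' uv by (intro poly_signs_convex[OF clos _ _ w(1)]) (auto simp: poly_signs_def)
      then show ?thesis using w(2) root by (intro exI[of _ w]) (auto simp: poly_signs_def)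
    qed
  qed
qed

section \<open>Quantifier elimination\<close>

definition same_signs :: "('x \<Rightarrow> real) set \<Rightarrow> 'x \<Rightarrow> 'x \<Rightarrow> bool" where
  "same_signs G x y \<longleftrightarrow> (\<forall>g\<in>G. sgn (g x) = sgn (g y))"

lemma same_signs_sym: "same_signs G x y \<Longrightarrow> same_signs G y x"
  by (auto simp: same_signs_def)

lemma same_signs_mono: "same_signs G x y \<Longrightarrow> H \<subseteq> G \<Longrightarrow> same_signs H x y"
  by (auto simp: same_signs_def)

definition coeffs_upto :: "('x \<Rightarrow> real poly) set \<Rightarrow> nat \<Rightarrow> ('x \<Rightarrow> real) set" where
  "coeffs_upto F d = (\<lambda>(P, i). (\<lambda>x. coeff (P x) i)) ` (F \<times> {..d})"

text \<open>Orders up to \<open>Suc d\<close> are included so that, for degrees at most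
  \<open>d\<close>, the last one is 0; this closes the family under differentiation.\<close>

definition iterated_pderivs :: "('x \<Rightarrow> real poly) set \<Rightarrow> nat \<Rightarrow> ('x \<Rightarrow> real poly) set" where
  "iterated_pderivs F d = (\<lambda>(i, P). (\<lambda>x. (pderiv ^^ i) (P x))) ` ({..Suc d} \<times> F)"

lemma poly_cutoff_eq:
  assumes "degree p \<le> n" shows "poly_cutoff (Suc n) p = p"
  using assms by (auto simp: poly_eq_iff coeff_poly_cutoff coeff_eq_0)

text \<open>Differentiation and pseudo-division apply only ring operations to coefficients, so any
  ring of functions containing the constants will do. It is instantiated with the polynomials in the
  remaining coordinates.\<close>

locale function_ring =
  fixes R :: "('x \<Rightarrow> real) set"
  assumes const: "(\<lambda>_. c) \<in> R"
    and add: "p \<in> R \<Longrightarrow> q \<in> R \<Longrightarrow> (\<lambda>x. p x + q x) \<in> R"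
    and mult: "p \<in> R \<Longrightarrow> q \<in> R \<Longrightarrow> (\<lambda>x. p x * q x) \<in> R"
begin

lemma diff: "p \<in> R \<Longrightarrow> q \<in> R \<Longrightarrow> (\<lambda>x. p x - q x) \<in> R"
  using add[OF _ mult[OF const[of "-1"]], of p q] by simp

lemma sum: "finite I \<Longrightarrow> (\<And>i. i \<in> I \<Longrightarrow> p i \<in> R) \<Longrightarrow> (\<lambda>x. \<Sum>i\<in>I. p i x) \<in> R"
  by (induction I rule: finite_induct) (auto intro: add const)

text \<open>\<open>d\<close> is a uniform bound and not the degree, which may drop at parameters
  where leading coefficients vanish.\<close>

definition param_polys :: "nat \<Rightarrow> ('x \<Rightarrow> real poly) set" where
  "param_polys d = {P. (\<forall>x. degree (P x) \<le> d) \<and> (\<forall>i. (\<lambda>x. coeff (P x) i) \<in> R)}"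

lemma param_polys_mono: "d \<le> e \<Longrightarrow> param_polys d \<subseteq> param_polys e"
  unfolding param_polys_def using order_trans by blast

lemma param_polys_pderiv: "P \<in> param_polys d \<Longrightarrow> (\<lambda>x. pderiv (P x)) \<in> param_polys (d - 1)"
  unfolding param_polys_def
  by (auto simp: coeff_pderiv degree_pderiv intro!: diff_le_mono mult const add)

lemma param_polys_add:
  "P \<in> param_polys d \<Longrightarrow> Q \<in> param_polys e \<Longrightarrow> (\<lambda>x. P x + Q x) \<in> param_polys (max d e)"
  unfolding param_polys_def
  by (auto intro!: add order_trans[OF degree_add_le_max] max.mono)

lemma param_polys_mult:
  assumes "P \<in> param_polys d" "Q \<in> param_polys e"
  shows "(\<lambda>x. P x * Q x) \<in> param_polys (d + e)"
proof -
  have "degree (P x * Q x) \<le> d + e" for x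
    using assms by (intro order_trans[OF degree_mult_le] add_mono) (auto simp: param_polys_def)
  then show ?thesis
    using assms by (auto simp: param_polys_def coeff_mult intro!: sum mult)
qed

lemma param_polys_const: "p \<in> R \<Longrightarrow> (\<lambda>x. [:p x:]) \<in> param_polys 0"
  unfolding param_polys_def
proof (intro CollectI conjI allI)
  fix i assume "p \<in> R"
  then show "(\<lambda>x. coeff [:p x:] i) \<in> R" by (cases i) (auto intro: const)
qed simp

text \<open>The degree of \<open>g x\<close> varies with \<open>x\<close>, so division is carried
  out separately for each possible degree \<open>j\<close>, with \<open>coeff (g x) j\<close> as
  leading coefficient. Multiplying by it at every step, which accumulates the power
  \<open>k\<close>, replaces dividing by it.\<close>

lemma pseudo_remainder_exists:
  assumes f: "f \<in> param_polys m" and g: "g \<in> param_polys n" and "j > 0"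
  shows "\<exists>r k. r \<in> param_polys (j - 1) \<and> (\<forall>x t. degree (g x) \<le> j \<longrightarrow> poly (g x) t = 0 \<longrightarrow>
    coeff (g x) j ^ k * poly (f x) t = poly (r x) t)"
  using f
proof (induction m arbitrary: f rule: less_induct)
  case (less m)
  show ?case
  proof (cases "m \<le> j - 1")
    case True
    then have "f \<in> param_polys (j - 1)" using param_polys_mono less.prems by blast
    then show ?thesis by (intro exI[of _ f] exI[of _ 0]) auto
  next
    case False
    \<comment> \<open>The degree bound on \<open>h\<close> must hold at all parameters, also where
      \<open>g x\<close> has degree above \<open>j\<close>; the cutoff keeps the subtracted product
      within degree \<open>m\<close> there. At the parameters in the conclusion the cutoff changes
      nothing.\<close>
    define h where "h x = smult (coeff (g x) j) (f x) -
      monom (coeff (f x) m) (m - j) * poly_cutoff (Suc j) (g x)" for x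
    have coR: "(\<lambda>x. coeff (f x) i) \<in> R" "(\<lambda>x. coeff (g x) i) \<in> R" for i
      using less.prems g by (auto simp: param_polys_def)
    have ch: "coeff (h x) i = coeff (g x) j * coeff (f x) i -
        (if i < m - j \<or> i > m then 0 else coeff (f x) m * coeff (g x) (i - (m - j)))" for x i
      using False \<open>j > 0\<close> by (auto simp: h_def coeff_monom_mult coeff_poly_cutoff)
    have "degree (h x) \<le> m - 1" for x
    proof (rule degree_le, intro allI impI)
      fix i assume "i > m - 1"
      then have "i = m \<or> i > m" by auto
      then show "coeff (h x) i = 0"
      proof
        assume "i = m"
        then show ?thesis using False \<open>j > 0\<close> by (simp add: ch)
      next
        assume "i > m"
        then have "coeff (f x) i = 0" using less.prems
          by (intro coeff_eq_0) (auto simp: param_polys_def intro: le_less_trans)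
        then show ?thesis using \<open>i > m\<close> by (simp add: ch)
      qed
    qed
    moreover have "(\<lambda>x. coeff (h x) i) \<in> R" for i
      unfolding ch using coR by (cases "i < m - j \<or> m < i") (simp_all add: diff mult const)
    ultimately have "h \<in> param_polys (m - 1)" by (auto simp: param_polys_def)
    moreover have "m - 1 < m" using False by simp
    ultimately obtain r k where rk: "r \<in> param_polys (j - 1)"
      "\<And>x t. degree (g x) \<le> j \<Longrightarrow> poly (g x) t = 0 \<Longrightarrow> coeff (g x) j ^ k * poly (h x) t = poly (r x) t"
      using less.IH by blast
    have "coeff (g x) j ^ Suc k * poly (f x) t = poly (r x) t"
      if "degree (g x) \<le> j" "poly (g x) t = 0" for x t
    proof -
      have "poly (h x) t = coeff (g x) j * poly (f x) t"
        using that by (simp add: h_def poly_cutoff_eq)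
      then show ?thesis using rk(2)[OF that] by (simp add: mult_ac)
    qed
    then show ?thesis using rk(1) by blast
  qed
qed

text \<open>Whether a given sign vector is realised over \<open>x\<close> depends only on the cell
  of \<open>x\<close>. One inclusion between the realised sign vectors suffices because
  \<open>same_signs\<close> is symmetric.\<close>

definition decided :: "('x \<Rightarrow> real poly) set \<Rightarrow> bool" where
  "decided F \<longleftrightarrow> (\<exists>G. finite G \<and> G \<subseteq> R \<and>
     (\<forall>x x'. same_signs G x x' \<longrightarrow> (\<forall>t. \<exists>t'. poly_signs F x t x' t')))"

lemma decided_subset: "decided F \<Longrightarrow> F' \<subseteq> F \<Longrightarrow> decided F'"
  unfolding decided_def poly_signs_def by (metis subsetD)

lemma coeffs_upto:
  assumes "finite F" "F \<subseteq> param_polys d"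
  shows "finite (coeffs_upto F d)" "coeffs_upto F d \<subseteq> R"
    "same_signs (coeffs_upto F d) x x' \<Longrightarrow> same_coeff_signs F x x'"
proof -
  show "finite (coeffs_upto F d)" "coeffs_upto F d \<subseteq> R"
    using assms by (auto simp: coeffs_upto_def param_polys_def)
  assume s: "same_signs (coeffs_upto F d) x x'"
  have "sgn (coeff (P x) i) = sgn (coeff (P x') i)" if "P \<in> F" for P i
  proof (cases "i \<le> d")
    case True
    then have "(\<lambda>x. coeff (P x) i) \<in> coeffs_upto F d" using that by (auto simp: coeffs_upto_def)
    then show ?thesis using s by (auto simp: same_signs_def)
  next
    case False
    have "degree (P y) \<le> d" for y using that assms(2) by (auto simp: param_polys_def)
    then have "coeff (P y) i = 0" for y using False
      by (intro coeff_eq_0) (meson le_less_trans not_le)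
    then show ?thesis by simp
  qed
  then show "same_coeff_signs F x x'" by (auto simp: same_coeff_signs_def)
qed

text \<open>At a root of \<open>P x\<close>, of degree \<open>j\<close>, the remainder is
  \<open>f\<close> times a power of the nonzero leading coefficient, so these two signs determine
  that of \<open>f\<close>. The case \<open>j = 0\<close> cannot occur, as a nonzero constant has no
  root.\<close>

lemma root_transfer_via_remainders:
  assumes F: "F \<subseteq> param_polys d" and coef: "same_coeff_signs F x x'"
    and rem: "\<And>P j x t. P \<in> F \<Longrightarrow> j \<in> {1..d} \<Longrightarrow> degree (P x) \<le> j \<Longrightarrow> poly (P x) t = 0 \<Longrightarrow>
      coeff (P x) j ^ k P j * poly (f x) t = poly (r P j x) t"
    and tr: "\<And>t. \<exists>t'. poly_signs (F \<union> {r P j | P j. P \<in> F \<and> j \<in> {1..d}}) x t x' t'"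
  shows "root_transfer F f x x'"
  unfolding root_transfer_def
proof
  fix t
  obtain t' where t': "poly_signs (F \<union> {r P j | P j. P \<in> F \<and> j \<in> {1..d}}) x t x' t'"
    using tr by blast
  have tF: "poly_signs F x t x' t'" using t' by (auto simp: poly_signs_def)
  moreover have "sgn (poly (f x) t) = sgn (poly (f x') t')" if "nonzero_root F x t"
  proof -
    obtain P where P: "P \<in> F" "P x \<noteq> 0" "poly (P x) t = 0"
      using \<open>nonzero_root F x t\<close> unfolding nonzero_root_def by blast
    define j where "j = degree (P x)"
    have j': "degree (P x') = j" using same_coeff_signs_degree[OF coef P(1)] by (simp add: j_def)
    have "j \<noteq> 0"
      using P(2,3) unfolding j_def by (metis degree_eq_zeroE pCons_0_0 poly_const_conv)
    then have j: "j \<in> {1..d}" using F P(1) by (auto simp: j_def param_polys_def)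
    have root': "poly (P x') t' = 0"
      using tF P(1,3) unfolding poly_signs_def by (metis sgn_eq_imp_zero_iff)
    have pow: "sgn (c ^ n) = sgn c ^ n" for c :: real and n
      by (induction n) (simp_all add: sgn_mult)
    have lc: "coeff (P x) j \<noteq> 0" using P(2) by (simp add: j_def)
    have lc': "sgn (coeff (P x) j) = sgn (coeff (P x') j)"
      using coef P(1) by (auto simp: same_coeff_signs_def)
    have "sgn (poly (r P j x) t) = sgn (poly (r P j x') t')"
      using t' P(1) j by (auto simp: poly_signs_def)
    moreover have "coeff (P x) j ^ k P j * poly (f x) t = poly (r P j x) t"
      using rem[OF P(1) j _ P(3)] by (simp add: j_def)
    moreover have "coeff (P x') j ^ k P j * poly (f x') t' = poly (r P j x') t'"
      using rem[OF P(1) j _ root'] j' by simp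
    ultimately have "sgn (coeff (P x) j ^ k P j * poly (f x) t) = sgn (coeff (P x') j ^ k P j * poly (f x') t')"
      by simp
    then have "sgn (coeff (P x) j) ^ k P j * sgn (poly (f x) t) =
      sgn (coeff (P x') j) ^ k P j * sgn (poly (f x') t')"
      by (simp only: sgn_mult pow)
    then show ?thesis using lc lc' by (auto simp: sgn_eq_0_iff sgn_eq_imp_zero_iff[OF lc'])
  qed
  ultimately show "\<exists>t'. poly_signs F x t x' t' \<and>
      (nonzero_root F x t \<longrightarrow> sgn (poly (f x) t) = sgn (poly (f x') t'))" by blast
qed

lemma iterated_pderivs:
  assumes "finite F" "F \<subseteq> param_polys d"
  shows "finite (iterated_pderivs F d)" "F \<subseteq> iterated_pderivs F d"
    "iterated_pderivs F d \<subseteq> param_polys d" "pderiv_closed (iterated_pderivs F d)"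
proof -
  show "finite (iterated_pderivs F d)" using assms by (simp add: iterated_pderivs_def)
  show "F \<subseteq> iterated_pderivs F d"
    unfolding iterated_pderivs_def by (force intro: image_eqI[where x = "(0, _)"])
  have deg: "(\<lambda>x. (pderiv ^^ i) (P x)) \<in> param_polys (d - i)" if "P \<in> F" for P i
  proof (induction i)
    case 0
    then show ?case using that assms by auto
  next
    case (Suc i)
    then show ?case using param_polys_pderiv[OF Suc] by simp
  qed
  then show "iterated_pderivs F d \<subseteq> param_polys d"
    using param_polys_mono[OF diff_le_self] unfolding iterated_pderivs_def by fast
  show "pderiv_closed (iterated_pderivs F d)"
    unfolding pderiv_closed_def
  proof
    fix Q assume "Q \<in> iterated_pderivs F d"
    then obtain i P where Q: "P \<in> F" "i \<le> Suc d" "Q = (\<lambda>x. (pderiv ^^ i) (P x))"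
      by (auto simp: iterated_pderivs_def)
    show "(\<lambda>x. pderiv (Q x)) \<in> iterated_pderivs F d"
    proof (cases "i = Suc d")
      case True
      have "degree ((pderiv ^^ d) (P x)) = 0" for x
        using deg[OF Q(1), of d] by (auto simp: param_polys_def)
      then have "Q = (\<lambda>x. 0)" using Q True by (auto simp: pderiv_eq_0_iff)
      moreover have "Q \<in> iterated_pderivs F d" by fact
      ultimately show ?thesis by simp
    next
      case False
      then show ?thesis
        using Q by (auto simp: iterated_pderivs_def intro!: image_eqI[where x = "(Suc i, P)"])
    qed
  qed
qed

text \<open>All derivatives, and the pseudo-remainders of \<open>f\<close> that determine its sign at the roots of the other
  members, have degree at most \<open>d\<close> and can therefore be added to \<open>B\<close>.\<close>

lemma decided_insert:
  assumes f: "f \<in> param_polys (Suc d)" and A: "finite A" "A \<subseteq> param_polys (Suc d)"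
    and B: "finite B" "B \<subseteq> param_polys d"
    and IH: "\<And>B. finite B \<Longrightarrow> B \<subseteq> param_polys d \<Longrightarrow> decided (A \<union> B)"
  shows "decided (insert f A \<union> B)"
proof -
  define D where "D = iterated_pderivs ((\<lambda>P x. pderiv (P x)) ` insert f A \<union> B) d"
  have sub: "(\<lambda>P x. pderiv (P x)) ` insert f A \<union> B \<subseteq> param_polys d"
    using f A(2) B(2) param_polys_pderiv[of _ "Suc d"] by auto
  have fin: "finite ((\<lambda>P x. pderiv (P x)) ` insert f A \<union> B)" using A(1) B(1) by simp
  note D = iterated_pderivs[OF fin sub, folded D_def]
  define F where "F = A \<union> D"
  have F: "finite F" "F \<subseteq> param_polys (Suc d)"
    using A D param_polys_mono[of d "Suc d"] by (auto simp: F_def)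
  have clos: "pderiv_closed F" using D(2,4) by (auto simp: F_def pderiv_closed_def)
  have fF: "(\<lambda>x. pderiv (f x)) \<in> F" using D(2) by (auto simp: F_def)
  have "\<forall>P j. \<exists>r k. P \<in> F \<and> j \<in> {1..Suc d} \<longrightarrow> r \<in> param_polys d \<and>
    (\<forall>x t. degree (P x) \<le> j \<longrightarrow> poly (P x) t = 0 \<longrightarrow> coeff (P x) j ^ k * poly (f x) t = poly (r x) t)"
  proof (intro allI)
    fix P j
    show "\<exists>r k. P \<in> F \<and> j \<in> {1..Suc d} \<longrightarrow> r \<in> param_polys d \<and>
      (\<forall>x t. degree (P x) \<le> j \<longrightarrow> poly (P x) t = 0 \<longrightarrow> coeff (P x) j ^ k * poly (f x) t = poly (r x) t)"
    proof (cases "P \<in> F \<and> j \<in> {1..Suc d}")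
      case True
      then have "P \<in> param_polys (Suc d)" "j > 0" "j - 1 \<le> d" using F by auto
      with pseudo_remainder_exists[OF f, of P] show ?thesis
        using param_polys_mono[of "j - 1" d] by (meson subsetD)
    qed auto
  qed
  then obtain r k where rk: "\<And>P j. P \<in> F \<Longrightarrow> j \<in> {1..Suc d} \<Longrightarrow> r P j \<in> param_polys d"
    "\<And>P j x t. P \<in> F \<Longrightarrow> j \<in> {1..Suc d} \<Longrightarrow> degree (P x) \<le> j \<Longrightarrow> poly (P x) t = 0 \<Longrightarrow>
      coeff (P x) j ^ k P j * poly (f x) t = poly (r P j x) t"
    by metis
  define S where "S = {r P j | P j. P \<in> F \<and> j \<in> {1..Suc d}}"
  have "S = (\<lambda>(P, j). r P j) ` (F \<times> {1..Suc d})" unfolding S_def by force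
  then have S: "finite S" "S \<subseteq> param_polys d" using F(1) rk(1) by (simp, auto simp: S_def)
  have "decided (A \<union> (D \<union> S))" using IH[of "D \<union> S"] D(1,3) S by simp
  then obtain G where G: "finite G" "G \<subseteq> R"
    "\<And>x x' t. same_signs G x x' \<Longrightarrow> \<exists>t'. poly_signs (F \<union> S) x t x' t'"
    unfolding decided_def F_def by (metis sup_assoc)
  have fins: "finite (insert f F)" "insert f F \<subseteq> param_polys (Suc d)" using F f by auto
  \<comment> \<open>The coefficients are added so that degrees and identical vanishing agree at the
    two parameters, as the transfer requires.\<close>
  define H where "H = G \<union> coeffs_upto (insert f F) (Suc d)"
  have H: "finite H" "H \<subseteq> R" using G(1,2) coeffs_upto(1,2)[OF fins] by (auto simp: H_def)
  have main: "\<exists>t'. poly_signs (insert f F) x t x' t'" if "same_signs H x x'" for x x' t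
  proof (rule transfer_insert[OF F(1) clos fF])
    show coef: "same_coeff_signs (insert f F) x x'"
      using coeffs_upto(3)[OF fins] that by (auto simp: H_def same_signs_def)
    then have coefF: "same_coeff_signs F x x'" "same_coeff_signs F x' x"
      by (auto simp: same_coeff_signs_def)
    have GG: "same_signs G x x'" "same_signs G x' x" using that by (auto simp: H_def same_signs_def)
    show "root_transfer F f x x'"
      by (rule root_transfer_via_remainders[OF F(2) coefF(1) rk(2)])
         (use G(3)[OF GG(1)] in \<open>auto simp: S_def\<close>)
    show "root_transfer F f x' x"
      by (rule root_transfer_via_remainders[OF F(2) coefF(2) rk(2)])
         (use G(3)[OF GG(2)] in \<open>auto simp: S_def\<close>)
  qed
  then have "decided (insert f F)" unfolding decided_def using H by blast
  then show ?thesis by (rule decided_subset) (use D(2) in \<open>auto simp: F_def\<close>)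
qed

theorem decided_finite:
  "finite F \<Longrightarrow> F \<subseteq> param_polys d \<Longrightarrow> decided F"
proof (induction d arbitrary: F)
  case 0
  have "\<exists>t'. poly_signs F x t x' t'" if "same_signs (coeffs_upto F 0) x x'" for x x' t
  proof -
    have "poly (P y) s = coeff (P y) 0" if "P \<in> F" for P y s
    proof -
      have "degree (P y) = 0" using that 0(2) by (auto simp: param_polys_def)
      then show ?thesis by (auto elim: degree_eq_zeroE)
    qed
    then have "poly_signs F x t x' t"
      using coeffs_upto(3)[OF 0 that] by (auto simp: poly_signs_def same_coeff_signs_def)
    then show ?thesis by blast
  qed
  then show ?case unfolding decided_def using coeffs_upto(1,2)[OF 0] by blast
next
  case (Suc d)
  have "decided (A \<union> B)" if "finite A" "A \<subseteq> param_polys (Suc d)" "finite B" "B \<subseteq> param_polys d" for A B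
    using that
  proof (induction A arbitrary: B rule: finite_induct)
    case empty
    then show ?case using Suc.IH by simp
  next
    case (insert f A)
    show ?case by (rule decided_insert) (use insert in auto)
  qed
  from this[of F "{}"] Suc.prems show ?case by simp
qed

end

section \<open>Connected sign cells\<close>

text \<open>Polynomials in the coordinates \<open>B\<close> only, yet still functions on the whole
  space: induction on the dimension becomes induction on \<open>B\<close> within one type.\<close>

inductive_set polyfuns :: "'a::euclidean_space set \<Rightarrow> ('a \<Rightarrow> real) set" for B where
  const: "(\<lambda>_. c) \<in> polyfuns B"
| coord: "b \<in> B \<Longrightarrow> (\<lambda>x. x \<bullet> b) \<in> polyfuns B"
| add: "p \<in> polyfuns B \<Longrightarrow> q \<in> polyfuns B \<Longrightarrow> (\<lambda>x. p x + q x) \<in> polyfuns B"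
| mult: "p \<in> polyfuns B \<Longrightarrow> q \<in> polyfuns B \<Longrightarrow> (\<lambda>x. p x * q x) \<in> polyfuns B"

interpretation poly_ring: function_ring "polyfuns B" for B :: "'a::euclidean_space set"
  by unfold_locales (auto intro: polyfuns.intros)

lemma polyfuns_mono: "B \<subseteq> B' \<Longrightarrow> polyfuns B \<subseteq> polyfuns B'"
proof
  fix p assume "B \<subseteq> B'" "p \<in> polyfuns B"
  from this(2,1) show "p \<in> polyfuns B'"
    by induction (auto intro: polyfuns.intros)
qed

lemma polyfuns_Basis: "polyfuns Basis = Collect real_polynomial_function"
proof (intro equalityI subsetI CollectI)
  fix p :: "'a \<Rightarrow> real" assume "p \<in> polyfuns Basis"
  then show "real_polynomial_function p"
    by induction (auto intro: bounded_linear_inner_left)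
next
  fix p :: "'a \<Rightarrow> real" assume "p \<in> Collect real_polynomial_function"
  then have "real_polynomial_function p" by simp
  then show "p \<in> polyfuns Basis"
  proof induction
    case (linear f)
    then have lin: "linear f" by (rule bounded_linear.linear)
    have "f x = (\<Sum>b\<in>Basis. (x \<bullet> b) * f b)" for x
    proof -
      have "f x = f (\<Sum>b\<in>Basis. (x \<bullet> b) *\<^sub>R b)" by (simp add: euclidean_representation)
      also have "\<dots> = (\<Sum>b\<in>Basis. (x \<bullet> b) * f b)"
        by (simp add: linear_sum[OF lin] linear_cmul[OF lin])
      finally show ?thesis .
    qed
    then have "f = (\<lambda>x. \<Sum>b\<in>Basis. (x \<bullet> b) * f b)" by (rule ext)
    moreover have "(\<lambda>x. \<Sum>b\<in>Basis. (x \<bullet> b) * f b) \<in> polyfuns Basis"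
      by (intro poly_ring.sum[where p = "\<lambda>b x. (x \<bullet> b) * f b"] polyfuns.mult
          polyfuns.coord polyfuns.const finite_Basis)
    ultimately show ?case by simp
  qed (auto intro: polyfuns.intros)
qed

lemma polyfuns_continuous: "p \<in> polyfuns B \<Longrightarrow> continuous_on S p"
  by (induction rule: polyfuns.induct) (auto intro!: continuous_intros)

lemma polyfuns_invariant:
  assumes "p \<in> polyfuns B" "B \<subseteq> Basis" "b \<in> Basis" "b \<notin> B"
  shows "p (x + t *\<^sub>R b) = p x"
  using assms
proof (induction rule: polyfuns.induct)
  case (coord c)
  then have "b \<bullet> c = 0" by (metis inner_Basis subsetD)
  then show ?case by (simp add: inner_add_left)
qed auto

lemma polyfuns_empty: "p \<in> polyfuns {} \<Longrightarrow> p x = p y"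
  by (induction rule: polyfuns.induct) auto

section \<open>Polynomials in one distinguished coordinate\<close>

definition eval_along :: "'a::euclidean_space \<Rightarrow> ('a \<Rightarrow> real poly) \<Rightarrow> 'a \<Rightarrow> real" where
  "eval_along b P z = poly (P z) (z \<bullet> b)"

lemma polyfuns_insert_representation:
  assumes "p \<in> polyfuns (insert b B)"
  shows "\<exists>d P. P \<in> poly_ring.param_polys B d \<and> p = eval_along b P"
  using assms
proof (induction rule: polyfuns.induct)
  case (const c)
  then show ?case
    using poly_ring.param_polys_const[OF polyfuns.const[of c B]] by (force simp: eval_along_def)
next
  case (coord c)
  show ?case
  proof (cases "c = b")
    case True
    have "(\<lambda>x. [:0, 1:]) \<in> poly_ring.param_polys B 1"
      by (auto simp: poly_ring.param_polys_def intro: polyfuns.const)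
    then show ?thesis using True by (force simp: eval_along_def)
  next
    case False
    then have "(\<lambda>x. x \<bullet> c) \<in> polyfuns B" using coord by (auto intro: polyfuns.coord)
    from poly_ring.param_polys_const[OF this] show ?thesis by (force simp: eval_along_def)
  qed
next
  case (add p q)
  then obtain d P e Q where *: "P \<in> poly_ring.param_polys B d" "Q \<in> poly_ring.param_polys B e"
    "p = eval_along b P" "q = eval_along b Q" by blast
  show ?case
    by (rule exI, rule exI, rule conjI[OF poly_ring.param_polys_add[OF *(1,2)]])
       (simp add: * eval_along_def fun_eq_iff)
next
  case (mult p q)
  then obtain d P e Q where *: "P \<in> poly_ring.param_polys B d" "Q \<in> poly_ring.param_polys B e"
    "p = eval_along b P" "q = eval_along b Q" by blast
  show ?case
    by (rule exI, rule exI, rule conjI[OF poly_ring.param_polys_mult[OF *(1,2)]])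
       (simp add: * eval_along_def fun_eq_iff)
qed

lemma finite_polyfuns_insert_representation:
  assumes "finite G" "G \<subseteq> polyfuns (insert b B)"
  shows "\<exists>d F. finite F \<and> F \<subseteq> poly_ring.param_polys B d \<and> G = eval_along b ` F"
  using assms
proof (induction rule: finite_induct)
  case (insert p G)
  then obtain d F where F: "finite F" "F \<subseteq> poly_ring.param_polys B d" "G = eval_along b ` F" by auto
  obtain e P where P: "P \<in> poly_ring.param_polys B e" "p = eval_along b P"
    using polyfuns_insert_representation insert.prems by blast
  have "insert P F \<subseteq> poly_ring.param_polys B (max d e)"
    using F(2) P(1) poly_ring.param_polys_mono[of d "max d e" B]
      poly_ring.param_polys_mono[of e "max d e" B] by auto
  then show ?case using F P by (intro exI[of _ "max d e"] exI[of _ "insert P F"]) auto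
qed auto

text \<open>A range of summation that does not jump with the degree of \<open>P z\<close>; it makes
  polynomial dependence and joint continuity visible.\<close>

lemma param_polys_poly_eq:
  assumes "P \<in> poly_ring.param_polys B d"
  shows "poly (P z) t = (\<Sum>i\<le>d. coeff (P z) i * t ^ i)"
proof -
  have "degree (P z) \<le> d" using assms by (auto simp: poly_ring.param_polys_def)
  then show ?thesis unfolding poly_altdef
    by (intro sum.mono_neutral_left) (auto simp: coeff_eq_0)
qed

lemma eval_along_polyfuns:
  assumes P: "P \<in> poly_ring.param_polys B d"
  shows "eval_along b P \<in> polyfuns (insert b B)"
proof -
  have c: "(\<lambda>z. coeff (P z) i) \<in> polyfuns (insert b B)" for i
    using P polyfuns_mono[of B "insert b B"] by (auto simp: poly_ring.param_polys_def)
  have pw: "(\<lambda>z. (z \<bullet> b) ^ i) \<in> polyfuns (insert b B)" for i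
    by (induction i) (auto intro: polyfuns.intros)
  have "(\<lambda>z. \<Sum>i\<le>d. coeff (P z) i * (z \<bullet> b) ^ i) \<in> polyfuns (insert b B)"
    by (intro poly_ring.sum polyfuns.mult c pw) auto
  moreover have "eval_along b P = (\<lambda>z. \<Sum>i\<le>d. coeff (P z) i * (z \<bullet> b) ^ i)"
    by (simp add: eval_along_def fun_eq_iff param_polys_poly_eq[OF P])
  ultimately show ?thesis by simp
qed

lemma param_polys_continuous:
  assumes P: "P \<in> poly_ring.param_polys B d"
  shows "isCont (\<lambda>(z, t). poly (P z) t) a"
proof -
  have "continuous_on S (\<lambda>z. coeff (P z) i)" for i S
    using P by (intro polyfuns_continuous) (auto simp: poly_ring.param_polys_def)
  then have "continuous_on UNIV (\<lambda>a. \<Sum>i\<le>d. coeff (P (fst a)) i * snd a ^ i)"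
    by (intro continuous_intros continuous_on_compose2[of UNIV _ UNIV fst]) auto
  moreover have "(\<lambda>(z, t). poly (P z) t) = (\<lambda>a. \<Sum>i\<le>d. coeff (P (fst a)) i * snd a ^ i)"
    by (simp add: fun_eq_iff param_polys_poly_eq[OF P])
  ultimately show ?thesis by (metis continuous_on_eq_continuous_at open_UNIV UNIV_I)
qed

text \<open>Signs near a multiple root could be split among several roots; Thom's lemma excludes this as
  long as every sign vector realised near \<open>x0\<close> is also realised at \<open>x0\<close>.\<close>

lemma poly_signs_persist:
  fixes F :: "('x::t2_space \<Rightarrow> real poly) set"
  assumes fin: "finite F" and clos: "pderiv_closed F"
    and cont: "\<And>P a. P \<in> F \<Longrightarrow> isCont (\<lambda>(x, t). poly (P x) t) a"
    and coef: "\<And>x. x \<in> C \<Longrightarrow> same_coeff_signs F x0 x"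
    and real: "\<And>x t. x \<in> C \<Longrightarrow> \<exists>s. poly_signs F x t x0 s"
    and "\<eta> > 0"
  shows "\<forall>\<^sub>F x in nhds x0. x \<in> C \<longrightarrow> (\<exists>t. dist t t0 < \<eta> \<and> poly_signs F x0 t0 x t)"
proof -
  have lim: "((\<lambda>(x, t). poly (P x) t) \<longlongrightarrow> poly (P x1) t1) (nhds (x1, t1))" if "P \<in> F" for P x1 t1
    using cont[OF that, of "(x1, t1)"] unfolding isCont_def tendsto_at_iff_tendsto_nhds by simp
  have "\<forall>\<^sub>F a in nhds (x0, t0). \<forall>P\<in>{P\<in>F. poly (P x0) t0 \<noteq> 0}.
      sgn (case a of (x, t) \<Rightarrow> poly (P x) t) = sgn (poly (P x0) t0)"
    by (rule eventually_ball_finite) (use fin lim in \<open>auto intro!: sgn_tendsto_nonzero\<close>)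
  then obtain U V where U: "\<forall>\<^sub>F x in nhds x0. U x" and V: "\<forall>\<^sub>F t in nhds t0. V t"
    and UV: "\<And>x t P. U x \<Longrightarrow> V t \<Longrightarrow> P \<in> F \<Longrightarrow> poly (P x0) t0 \<noteq> 0 \<Longrightarrow> sgn (poly (P x) t) = sgn (poly (P x0) t0)"
    unfolding nhds_prod eventually_prod_filter by auto
  show ?thesis
  proof (cases "nonzero_root F x0 t0")
    case False
    have "poly_signs F x0 t0 x t0" if "U x" "x \<in> C" for x
      unfolding poly_signs_def
    proof
      fix P assume P: "P \<in> F"
      show "sgn (poly (P x0) t0) = sgn (poly (P x) t0)"
      proof (cases "P x0 = 0")
        case True
        then have "P x = 0" using same_coeff_signs_zero_iff[OF coef[OF that(2)] P] by simp
        then show ?thesis using True by simp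
      next
        case nz: False
        then have "poly (P x0) t0 \<noteq> 0" using False P by (auto simp: nonzero_root_def)
        then show ?thesis using UV[OF that(1) _ P] eventually_nhds_x_imp_x[OF V] by metis
      qed
    qed
    then have "x \<in> C \<longrightarrow> (\<exists>t. dist t t0 < \<eta> \<and> poly_signs F x0 t0 x t)" if "U x" for x
      using that \<open>\<eta> > 0\<close> by (metis dist_self)
    then show ?thesis by (rule eventually_mono[OF U])
  next
    case True
    then obtain g0 where g0: "g0 \<in> F \<and> g0 x0 \<noteq> 0 \<and> poly (g0 x0) t0 = 0"
      by (auto simp: nonzero_root_def)
    \<comment> \<open>Least degree makes \<open>t0\<close> a simple root of \<open>g\<close>: the
      derivative is in \<open>F\<close> and has smaller degree, so it cannot vanish there. The
      resulting sign change survives small changes of the parameter and yields a root of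
      \<open>g x\<close> near \<open>t0\<close>.\<close>
    obtain g where g: "g \<in> F" "g x0 \<noteq> 0" "poly (g x0) t0 = 0"
      and min: "\<And>h. h \<in> F \<Longrightarrow> h x0 \<noteq> 0 \<Longrightarrow> poly (h x0) t0 = 0 \<Longrightarrow> degree (g x0) \<le> degree (h x0)"
      using ex_has_least_nat[of "\<lambda>g. g \<in> F \<and> g x0 \<noteq> 0 \<and> poly (g x0) t0 = 0", OF g0, of "\<lambda>g. degree (g x0)"]
      by blast
    have deg: "degree (g x0) \<noteq> 0"
      using g(2,3) by (metis degree_eq_zeroE pCons_0_0 poly_const_conv)
    have simple: "poly (pderiv (g x0)) t0 \<noteq> 0"
    proof
      assume "poly (pderiv (g x0)) t0 = 0"
      moreover have "pderiv (g x0) \<noteq> 0" using deg by (simp add: pderiv_eq_0_iff)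
      moreover have "(\<lambda>x. pderiv (g x)) \<in> F" using clos g(1) by (auto simp: pderiv_closed_def)
      ultimately have "degree (g x0) \<le> degree (pderiv (g x0))" using min by blast
      then show False using deg by (simp add: degree_pderiv)
    qed
    obtain \<delta> where \<delta>: "\<delta> > 0" "\<And>t. dist t t0 < \<delta> \<Longrightarrow> V t"
      using V unfolding eventually_nhds_metric by blast
    obtain h where h: "0 < h" "h < min \<eta> \<delta>" "poly (g x0) (t0 - h) * poly (g x0) (t0 + h) < 0"
      using simple_root_sign_change[OF g(3) simple, of "min \<eta> \<delta>"] \<open>\<eta> > 0\<close> \<delta>(1) by auto
    have lim_x: "((\<lambda>x. poly (g x) t) \<longlongrightarrow> poly (g x0) t) (nhds x0)" for t
    proof -
      have "((\<lambda>x. (x, t)) \<longlongrightarrow> (x0, t)) (nhds x0)" by (intro tendsto_intros filterlim_ident)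
      from filterlim_compose[OF lim[OF g(1)] this] show ?thesis by simp
    qed
    have "\<forall>\<^sub>F x in nhds x0. poly (g x) (t0 - h) * poly (g x) (t0 + h) < 0"
      using h(3) by (intro order_tendstoD(2)[OF tendsto_mult[OF lim_x lim_x]])
    then show ?thesis
      using U
    proof eventually_elim
      case (elim x)
      show ?case
      proof
        assume x: "x \<in> C"
        obtain t where t: "t \<in> closed_segment (t0 - h) (t0 + h)" "poly (g x) t = 0"
          using poly_IVT_segment[of "g x" "t0 - h" "t0 + h"] elim(1) by auto
        have near: "dist t t0 < \<eta>" "V t"
          using t(1) h(1,2) by (auto intro!: \<delta>(2) simp: dist_real_def closed_segment_eq_real_ivl)
        \<comment> \<open>Both \<open>s\<close> and \<open>t0\<close> belong to the single parameter
          \<open>x0\<close>. Members nonzero at \<open>t0\<close> keep their sign at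
          \<open>s\<close>, so the two are compatible, and if they differed, Thom's lemma would make
          \<open>g x0\<close> vanish on the segment between them.\<close>
        obtain s where s: "poly_signs F x t x0 s" using real[OF x] by blast
        have keep: "sgn (poly (P x0) s) = sgn (poly (P x0) t0)" if "P \<in> F" "poly (P x0) t0 \<noteq> 0" for P
          using UV[OF elim(2) near(2) that] s that(1) by (auto simp: poly_signs_def)
        have compat: "poly (P x0) t0 * poly (P x0) s \<ge> 0" if "P \<in> F" for P
          using keep[OF that]
          by (cases "poly (P x0) t0 = 0") (auto simp: sgn_real_def zero_le_mult_iff split: if_splits)
        have gs: "poly (g x0) s = 0" using s g(1) t(2) sgn_eq_imp_zero_iff by (metis poly_signs_def)
        have "s = t0"
        proof (rule ccontr)
          assume "s \<noteq> t0"
          have "poly (g x0) z = 0" if "z \<in> closed_segment t0 s" for z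
          proof -
            have "sgn (poly (g x0) z) \<in> {sgn (poly (g x0) t0), sgn (poly (g x0) s)}"
              using compat by (intro thom_family[OF clos _ g(1) that]) auto
            then show ?thesis using g(3) gs by (simp add: sgn_eq_0_iff)
          qed
          then show False using poly_eq_0_if_zero_on_segment \<open>s \<noteq> t0\<close> g(2) by metis
        qed
        then have "poly_signs F x0 t0 x t" using s by (auto simp: poly_signs_def)
        then show "\<exists>t. dist t t0 < \<eta> \<and> poly_signs F x0 t0 x t" using near(1) by blast
      qed
    qed
  qed
qed

text \<open>\<open>C\<close> is invariant along \<open>b\<close>, so it contains \<open>E\<close>
  and at the same time serves as its base. If two open sets separated \<open>E\<close>, the base
  points over which they meet \<open>E\<close> would form two relatively open sets, by lifting.
  These cover \<open>C\<close> and are disjoint, because a convex fibre cannot be split; this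
  contradicts the connectedness of \<open>C\<close>.\<close>

lemma connected_fibered:
  fixes E :: "'a::real_inner set" and b :: 'a
  assumes C: "connected C"
    and proj: "\<And>z t. z \<in> C \<Longrightarrow> z + (t - z \<bullet> b) *\<^sub>R b \<in> C"
    and b: "b \<bullet> b = 1" and sub: "E \<subseteq> C"
    and surj: "\<And>z. z \<in> C \<Longrightarrow> \<exists>t. z + (t - z \<bullet> b) *\<^sub>R b \<in> E"
    and fib: "\<And>z. z \<in> C \<Longrightarrow> convex {t. z + (t - z \<bullet> b) *\<^sub>R b \<in> E}"
    and lift: "\<And>z t \<eta>. z \<in> C \<Longrightarrow> z + (t - z \<bullet> b) *\<^sub>R b \<in> E \<Longrightarrow> \<eta> > 0 \<Longrightarrow>
      \<forall>\<^sub>F x in nhds z. x \<in> C \<longrightarrow> (\<exists>s. dist s t < \<eta> \<and> x + (s - x \<bullet> b) *\<^sub>R b \<in> E)"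
  shows "connected E"
proof (rule ccontr)
  define m where "m z t = z + (t - z \<bullet> b) *\<^sub>R b" for z and t :: real
  assume "\<not> connected E"
  then obtain U V where UV: "open U" "open V" "E \<subseteq> U \<union> V" "U \<inter> V \<inter> E = {}" "U \<inter> E \<noteq> {}" "V \<inter> E \<noteq> {}"
    unfolding connected_def by blast
  define base where "base W = {z \<in> C. \<exists>t. m z t \<in> E \<inter> W}" for W
  have nonempty: "base W \<noteq> {}" if "W \<inter> E \<noteq> {}" for W
  proof -
    obtain z where z: "z \<in> W" "z \<in> E" using \<open>W \<inter> E \<noteq> {}\<close> by blast
    then have "m z (z \<bullet> b) \<in> E \<inter> W" by (simp add: m_def)
    then show ?thesis using z sub unfolding base_def by blast
  qed
  have openin: "openin (top_of_set C) (base W)" if W: "open W" for W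
    unfolding openin_contains_ball
  proof (intro conjI ballI)
    show "base W \<subseteq> C" by (auto simp: base_def)
    fix z assume "z \<in> base W"
    then obtain t where z: "z \<in> C" "m z t \<in> E" "m z t \<in> W" by (auto simp: base_def)
    have "((\<lambda>(x, s). m x s) \<longlongrightarrow> m z t) (nhds z \<times>\<^sub>F nhds t)"
      unfolding m_def case_prod_beta
      by (intro tendsto_intros filterlim_fst filterlim_snd)
    then have "\<forall>\<^sub>F a in nhds z \<times>\<^sub>F nhds t. (case a of (x, s) \<Rightarrow> m x s) \<in> W"
      using W z(3) by (rule topological_tendstoD)
    then obtain Q S where Q: "\<forall>\<^sub>F x in nhds z. Q x" and S: "\<forall>\<^sub>F s in nhds t. S s"
      and QS: "\<And>x s. Q x \<Longrightarrow> S s \<Longrightarrow> m x s \<in> W"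
      unfolding eventually_prod_filter by auto
    obtain \<eta> where \<eta>: "\<eta> > 0" "\<And>s. dist s t < \<eta> \<Longrightarrow> S s"
      using S unfolding eventually_nhds_metric by blast
    have "\<forall>\<^sub>F x in nhds z. x \<in> C \<longrightarrow> x \<in> base W"
      using lift[OF z(1) z(2)[unfolded m_def] \<eta>(1)] Q
    proof eventually_elim
      case (elim x)
      then show ?case using QS \<eta>(2) unfolding base_def m_def by blast
    qed
    then obtain e where "e > 0" "\<And>x. dist x z < e \<Longrightarrow> x \<in> C \<Longrightarrow> x \<in> base W"
      unfolding eventually_nhds_metric by blast
    then show "\<exists>e>0. ball z e \<inter> C \<subseteq> base W" by (intro exI[of _ e]) (auto simp: dist_commute)
  qed
  have cover: "C \<subseteq> base U \<union> base V"
    using surj UV(3) unfolding base_def m_def by blast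
  have disj: "base U \<inter> base V = {}"
  proof (rule ccontr)
    assume "base U \<inter> base V \<noteq> {}"
    then obtain z s t where z: "z \<in> C" "m z s \<in> E \<inter> U" "m z t \<in> E \<inter> V" by (auto simp: base_def)
    have "connected (m z ` {t. m z t \<in> E})"
    proof (rule connected_continuous_image)
      show "continuous_on {t. m z t \<in> E} (m z)" unfolding m_def by (intro continuous_intros)
      show "connected {t. m z t \<in> E}" using fib[OF z(1)] unfolding m_def by (rule convex_connected)
    qed
    then show False using UV z unfolding connected_def by blast
  qed
  show False
    using C openin[OF UV(1)] openin[OF UV(2)] cover disj nonempty[OF UV(5)] nonempty[OF UV(6)]
    unfolding connected_openin by blast
qed

lemma param_polys_invariant:
  assumes "P \<in> poly_ring.param_polys B d" "B \<subseteq> Basis" "b \<in> Basis" "b \<notin> B"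
  shows "P (x + t *\<^sub>R b) = P x"
proof (rule poly_eqI)
  fix i
  have "(\<lambda>x. coeff (P x) i) \<in> polyfuns B" using assms(1) by (auto simp: poly_ring.param_polys_def)
  from polyfuns_invariant[OF this assms(2-4)] show "coeff (P (x + t *\<^sub>R b)) i = coeff (P x) i" .
qed

text \<open>A weak cylindrical decomposition. All points of a connected cell in the coordinates
  \<open>B\<close> realise the same sign vectors of a family closed under differentiation. Hence the
  cell above has nonempty fibres, convex by Thom's lemma, and \<open>poly_signs_persist\<close>
  supplies the lifting for \<open>connected_fibered\<close>.\<close>

theorem connected_sign_cells:
  assumes "finite B" "B \<subseteq> Basis" "finite G" "G \<subseteq> polyfuns B"
  shows "\<exists>G'. finite G' \<and> G \<subseteq> G' \<and> G' \<subseteq> polyfuns B \<and> (\<forall>z. connected {w. same_signs G' z w})"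
  using assms
proof (induction B arbitrary: G rule: finite_induct)
  case empty
  have "g z = g w" if "g \<in> G" for g z w
    using empty.prems(3) that by (intro polyfuns_empty) auto
  then have "same_signs G z w" for z w
    unfolding same_signs_def by metis
  then have "{w. same_signs G z w} = UNIV" for z by simp
  then show ?case using empty.prems by (intro exI[of _ G]) (auto simp: connected_UNIV)
next
  case (insert b B)
  then have B: "B \<subseteq> Basis" "b \<in> Basis" "b \<notin> B" by auto
  obtain d F0 where F0: "finite F0" "F0 \<subseteq> poly_ring.param_polys B d" "G = eval_along b ` F0"
    using finite_polyfuns_insert_representation[OF insert.prems(2,3)] by blast
  define F where "F = iterated_pderivs F0 d"
  note F = poly_ring.iterated_pderivs[OF F0(1,2), folded F_def]
  obtain H where H: "finite H" "H \<subseteq> polyfuns B"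
    "\<And>x x' t. same_signs H x x' \<Longrightarrow> \<exists>t'. poly_signs F x t x' t'"
    using poly_ring.decided_finite[OF F(1,3)] unfolding poly_ring.decided_def
    by (elim exE conjE) (rule that, assumption+, simp)
  note coeffs = poly_ring.coeffs_upto[OF F(1,3)]
  \<comment> \<open>Refining also by the coefficients makes their signs constant on each base cell,
    which \<open>poly_signs_persist\<close> requires.\<close>
  obtain H' where H': "finite H'" "H \<union> coeffs_upto F d \<subseteq> H'" "H' \<subseteq> polyfuns B"
      "\<And>z. connected {w. same_signs H' z w}"
    using insert.IH[OF B(1), of "H \<union> coeffs_upto F d"] H(1,2) coeffs(1,2) by (meson Un_least finite_UnI)
  define G' where "G' = H' \<union> eval_along b ` F"
  have inv: "p (z + t *\<^sub>R b) = p z" if "p \<in> H'" for p z t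
    using that H'(3) by (intro polyfuns_invariant[OF _ B]) blast
  have bb: "b \<bullet> b = 1" using B(2) by simp
  have ev: "eval_along b P (z + (t - z \<bullet> b) *\<^sub>R b) = poly (P z) t" if "P \<in> F" for P z t
    using param_polys_invariant[of P B d b z "t - z \<bullet> b"] that F(3) B bb
    by (auto simp: eval_along_def inner_add_left)
  have "connected {w. same_signs G' z0 w}" for z0
  proof (rule connected_fibered[where C = "{w. same_signs H' z0 w}" and b = b])
    let ?C = "{w. same_signs H' z0 w}" and ?E = "{w. same_signs G' z0 w}"
    have E_iff: "z + (t - z \<bullet> b) *\<^sub>R b \<in> ?E \<longleftrightarrow> poly_signs F z0 (z0 \<bullet> b) z t" if "z \<in> ?C" for z t
    proof -
      have "same_signs H' z0 (z + (t - z \<bullet> b) *\<^sub>R b)"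
        using that inv unfolding same_signs_def by force
      moreover have "eval_along b P z0 = poly (P z0) (z0 \<bullet> b)" for P by (simp add: eval_along_def)
      ultimately show ?thesis
        using ev[of _ z t] by (simp add: G'_def same_signs_def poly_signs_def ball_Un)
    qed
    have C_pair: "same_signs H' z w" if "z \<in> ?C" "w \<in> ?C" for z w
      using that by (auto simp: same_signs_def)
    have z0: "z0 \<in> ?C" by (simp add: same_signs_def)
    show "connected ?C" by (rule H'(4))
    show "z + (t - z \<bullet> b) *\<^sub>R b \<in> ?C" if "z \<in> ?C" for z t
      using that inv unfolding same_signs_def by force
    show "b \<bullet> b = 1" by (rule bb)
    show "?E \<subseteq> ?C" by (auto simp: G'_def same_signs_def)
    have trans: "\<exists>s. poly_signs F z t w s" if "z \<in> ?C" "w \<in> ?C" for z w t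
      using C_pair[OF that] H'(2) H(3) by (meson same_signs_mono le_sup_iff)
    show "\<exists>t. z + (t - z \<bullet> b) *\<^sub>R b \<in> ?E" if "z \<in> ?C" for z
      unfolding E_iff[OF that] using trans[OF z0 that] .
    show "convex {t. z + (t - z \<bullet> b) *\<^sub>R b \<in> ?E}" if "z \<in> ?C" for z
      unfolding E_iff[OF that] convex_contains_segment
      using poly_signs_convex[OF F(4)] by blast
    show "\<forall>\<^sub>F x in nhds z. x \<in> ?C \<longrightarrow> (\<exists>s. dist s t < \<eta> \<and> x + (s - x \<bullet> b) *\<^sub>R b \<in> ?E)"
      if z: "z \<in> ?C" "z + (t - z \<bullet> b) *\<^sub>R b \<in> ?E" and "\<eta> > 0" for z t \<eta>
    proof -
      have zt: "poly_signs F z0 (z0 \<bullet> b) z t" using z E_iff by blast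
      have "\<forall>\<^sub>F x in nhds z. x \<in> ?C \<longrightarrow> (\<exists>s. dist s t < \<eta> \<and> poly_signs F z t x s)"
      proof (rule poly_signs_persist[OF F(1,4)])
        show "isCont (\<lambda>(x, t). poly (P x) t) a" if "P \<in> F" for P a
          using param_polys_continuous that F(3) by blast
        show "same_coeff_signs F z x" if "x \<in> ?C" for x
          using C_pair[OF z(1) that] H'(2) coeffs(3) by (meson same_signs_mono le_sup_iff)
        show "\<exists>s. poly_signs F x t z s" if "x \<in> ?C" for x t by (rule trans[OF that z(1)])
      qed fact
      then show ?thesis
      proof eventually_elim
        case (elim x)
        show ?case
        proof
          assume x: "x \<in> ?C"
          then obtain s where "dist s t < \<eta>" "poly_signs F z t x s" using elim by blast
          moreover then have "poly_signs F z0 (z0 \<bullet> b) x s" using zt by (auto simp: poly_signs_def)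
          ultimately show "\<exists>s. dist s t < \<eta> \<and> x + (s - x \<bullet> b) *\<^sub>R b \<in> ?E"
            using E_iff[OF x] by blast
        qed
      qed
    qed
  qed
  moreover have "G \<subseteq> G'" using F0(3) F(2) by (auto simp: G'_def)
  moreover have "finite G'" using H'(1) F(1) by (simp add: G'_def)
  moreover have "G' \<subseteq> polyfuns (insert b B)"
    using H'(3) polyfuns_mono[of B "insert b B"] eval_along_polyfuns F(3) by (fastforce simp: G'_def)
  ultimately show ?case by blast
qed

section \<open>Semialgebraic sets\<close>

text \<open>Enlarging \<open>G\<close> preserves the property, so finitely many sets can share one
  family. An implication is enough because \<open>same_signs\<close> is symmetric.\<close>

definition saturated :: "('a \<Rightarrow> real) set \<Rightarrow> 'a set \<Rightarrow> bool" where
  "saturated G S \<longleftrightarrow> (\<forall>z w. same_signs G z w \<longrightarrow> z \<in> S \<longrightarrow> w \<in> S)"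

lemma saturated_mono: "saturated G S \<Longrightarrow> G \<subseteq> H \<Longrightarrow> saturated H S"
  unfolding saturated_def by (meson same_signs_mono)

lemma basic_semialgebraic_finite:
  assumes "finite A" "finite B" "A \<union> B \<subseteq> Collect real_polynomial_function"
  shows "basic_semialgebraic {x. (\<forall>p\<in>A. p x = 0) \<and> (\<forall>p\<in>B. p x > 0)}"
proof -
  obtain xs where xs: "set xs = A" using finite_list[OF assms(1)] by blast
  obtain ys where ys: "set ys = B" using finite_list[OF assms(2)] by blast
  \<comment> \<open>Equations come first, then inequalities; the shift accounts for numbering from 1
    in the definition and from 0 in lists.\<close>
  define p where "p i = (xs @ ys) ! (i - 1)" for i
  let ?k = "length xs" and ?m = "length xs + length ys"
  have px: "p (Suc i) = xs ! i" if "i < ?k" for i using that by (simp add: p_def nth_append)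
  have py: "p (i + ?k + 1) = ys ! i" for i by (simp add: p_def nth_append)
  have "p ` {1..?k} = p ` Suc ` {..<?k}" by (simp only: image_Suc_lessThan)
  also have "\<dots> = (!) xs ` {..<?k}" unfolding image_image by (rule image_cong) (use px in auto)
  finally have A: "p ` {1..?k} = A"
    by (auto simp: xs[symmetric] in_set_conv_nth)
  have "x \<in> (\<lambda>i. i + ?k + 1) ` {..<length ys}" if "x \<in> {?k + 1..?m}" for x
    by (rule image_eqI[of _ _ "x - ?k - 1"]) (use that in auto)
  then have "{?k + 1..?m} = (\<lambda>i. i + ?k + 1) ` {..<length ys}" by auto
  then have "p ` {?k + 1..?m} = (!) ys ` {..<length ys}"
    by (simp only: image_image py)
  then have B: "p ` {?k + 1..?m} = B"
    by (auto simp: ys[symmetric] in_set_conv_nth)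
  have split: "{1..?m} = {1..?k} \<union> {?k + 1..?m}" by auto
  have "\<forall>i\<in>{1..?m}. real_polynomial_function (p i)"
    using assms(3) unfolding split A[symmetric] B[symmetric] by auto
  moreover have "{x. (\<forall>p\<in>A. p x = 0) \<and> (\<forall>p\<in>B. p x > 0)} =
      {x. (\<forall>i\<in>{1..?k}. p i x = 0) \<and> (\<forall>i\<in>{?k+1..?m}. p i x > 0)}"
    unfolding A[symmetric] B[symmetric] by auto
  ultimately show ?thesis unfolding basic_semialgebraic_def
    by (intro exI[of _ p] exI[of _ ?k] exI[of _ ?m]) simp
qed

lemma basic_semialgebraic_saturated:
  fixes S :: "'a::euclidean_space set"
  assumes "basic_semialgebraic S"
  shows "\<exists>G. finite G \<and> G \<subseteq> polyfuns Basis \<and> saturated G S"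
proof -
  obtain p :: "nat \<Rightarrow> 'a \<Rightarrow> real" and k m where p: "k \<le> m"
    "\<forall>i\<in>{1..m}. real_polynomial_function (p i)"
    "S = {x. (\<forall>i\<in>{1..k}. p i x = 0) \<and> (\<forall>i\<in>{k+1..m}. p i x > 0)}"
    using assms unfolding basic_semialgebraic_def by (elim exE conjE) (rule that, assumption+)
  have "saturated (p ` {1..m}) S"
    unfolding saturated_def
  proof (intro allI impI)
    fix z w assume "same_signs (p ` {1..m}) z w" and z: "z \<in> S"
    then have s: "sgn (p i z) = sgn (p i w)" if "i \<in> {1..m}" for i
      using that unfolding same_signs_def by blast
    have "p i w = 0" if "i \<in> {1..k}" for i
      using s[of i] that z p(1,3) by (auto simp: sgn_eq_0_iff)
    moreover have "p i w > 0" if "i \<in> {k+1..m}" for i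
      using s[of i] that z p(1,3) by (auto simp: sgn_1_pos)
    ultimately show "w \<in> S" unfolding p(3) by blast
  qed
  then show ?thesis using p(2) by (intro exI[of _ "p ` {1..m}"]) (auto simp: polyfuns_Basis)
qed

lemma finite_saturated:
  assumes "finite I" "\<And>i. i \<in> I \<Longrightarrow> \<exists>G. finite G \<and> G \<subseteq> P \<and> saturated G (S i)"
  shows "\<exists>G. finite G \<and> G \<subseteq> P \<and> (\<forall>i\<in>I. saturated G (S i))"
  using assms
proof (induction I rule: finite_induct)
  case (insert i I)
  then obtain G H where "finite G" "G \<subseteq> P" "\<forall>i\<in>I. saturated G (S i)"
      "finite H" "H \<subseteq> P" "saturated H (S i)"
    by (meson insertI1 insertI2)
  then show ?case
    by (intro exI[of _ "G \<union> H"]) (auto intro: saturated_mono)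
qed auto

theorem semialgebraic_iff_saturated:
  fixes S :: "'a::euclidean_space set"
  shows "semialgebraic S \<longleftrightarrow> (\<exists>G. finite G \<and> G \<subseteq> polyfuns Basis \<and> saturated G S)"
proof
  assume "semialgebraic S"
  then obtain \<S> where \<S>: "finite \<S>" "\<And>A. A \<in> \<S> \<Longrightarrow> basic_semialgebraic A" "S = \<Union>\<S>"
    unfolding semialgebraic_def by blast
  obtain G where G: "finite G" "G \<subseteq> polyfuns Basis" "\<forall>A\<in>\<S>. saturated G A"
    using finite_saturated[of \<S> "polyfuns Basis" "\<lambda>A. A"] \<S> basic_semialgebraic_saturated by blast
  then have "saturated G S" unfolding \<S>(3) saturated_def by blast
  then show "\<exists>G. finite G \<and> G \<subseteq> polyfuns Basis \<and> saturated G S" using G by blast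
next
  assume "\<exists>G. finite G \<and> G \<subseteq> polyfuns Basis \<and> saturated G S"
  then obtain G where G: "finite G" "G \<subseteq> polyfuns Basis" "saturated G S" by blast
  let ?cell = "\<lambda>z. {w. same_signs G z w}"
  have "basic_semialgebraic (?cell z)" for z
  proof -
    \<comment> \<open>Basic sets offer only \<open>= 0\<close> and \<open>> 0\<close>, so members
      negative at \<open>z\<close> enter with the opposite sign.\<close>
    have "?cell z = {x. (\<forall>p\<in>{g\<in>G. g z = 0}. p x = 0) \<and>
        (\<forall>p\<in>{g\<in>G. g z > 0} \<union> (\<lambda>g x. - g x) ` {g\<in>G. g z < 0}. p x > 0)}"
    proof (intro set_eqI iffI CollectI)
      fix w assume "w \<in> ?cell z"
      then have s: "sgn (g z) = sgn (g w)" if "g \<in> G" for g using that by (auto simp: same_signs_def)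
      show "(\<forall>p\<in>{g\<in>G. g z = 0}. p w = 0) \<and>
        (\<forall>p\<in>{g\<in>G. g z > 0} \<union> (\<lambda>g x. - g x) ` {g\<in>G. g z < 0}. p w > 0)"
      proof (intro conjI ballI)
        fix p assume "p \<in> {g \<in> G. g z = 0}"
        then show "p w = 0" using s[of p] by (auto simp: sgn_eq_0_iff)
      next
        fix p assume "p \<in> {g\<in>G. g z > 0} \<union> (\<lambda>g x. - g x) ` {g\<in>G. g z < 0}"
        then show "p w > 0"
        proof
          assume "p \<in> {g\<in>G. g z > 0}"
          then show ?thesis using s[of p] by (auto simp: sgn_1_pos)
        next
          assume "p \<in> (\<lambda>g x. - g x) ` {g\<in>G. g z < 0}"
          then obtain g where "g \<in> G" "g z < 0" "p = (\<lambda>x. - g x)" by blast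
          then show ?thesis using s[of g, symmetric] by (auto simp: sgn_1_neg)
        qed
      qed
    next
      fix w assume w: "w \<in> {x. (\<forall>p\<in>{g\<in>G. g z = 0}. p x = 0) \<and>
        (\<forall>p\<in>{g\<in>G. g z > 0} \<union> (\<lambda>g x. - g x) ` {g\<in>G. g z < 0}. p x > 0)}"
      have "sgn (g z) = sgn (g w)" if "g \<in> G" for g
      proof (cases "g z" "0 :: real" rule: linorder_cases)
        case less
        then have "g w < 0" using w that by (simp add: ball_Un)
        then show ?thesis using less by simp
      qed (use w that in auto)
      then show "same_signs G z w" by (simp add: same_signs_def)
    qed
    moreover have "{g\<in>G. g z = 0} \<union> ({g\<in>G. g z > 0} \<union> (\<lambda>g x. - g x) ` {g\<in>G. g z < 0})
        \<subseteq> Collect real_polynomial_function"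
      using G(2) unfolding polyfuns_Basis by (auto intro: real_polynomial_function_minus)
    ultimately show ?thesis
      using basic_semialgebraic_finite[of "{g\<in>G. g z = 0}"
          "{g\<in>G. g z > 0} \<union> (\<lambda>g x. - g x) ` {g\<in>G. g z < 0}"] G(1) by simp
  qed
  moreover have "finite (?cell ` S)"
  proof (rule finite_subset)
    \<comment> \<open>There are finitely many cells because each is determined by its sign
      vector.\<close>
    show "?cell ` S \<subseteq> (\<lambda>\<phi>. {w. \<forall>g\<in>G. \<phi> g = sgn (g w)}) ` (\<Pi>\<^sub>E g\<in>G. {-1, 0, 1})"
    proof
      fix A assume "A \<in> ?cell ` S"
      then obtain z where "A = ?cell z" by blast
      then have "A = {w. \<forall>g\<in>G. restrict (\<lambda>g. sgn (g z)) G g = sgn (g w)}"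
        by (auto simp: same_signs_def)
      moreover have "restrict (\<lambda>g. sgn (g z)) G \<in> (\<Pi>\<^sub>E g\<in>G. {-1, 0, 1})"
        by (auto simp: sgn_real_def)
      ultimately show "A \<in> (\<lambda>\<phi>. {w. \<forall>g\<in>G. \<phi> g = sgn (g w)}) ` (\<Pi>\<^sub>E g\<in>G. {-1, 0, 1})"
        by blast
    qed
    show "finite ((\<lambda>\<phi>. {w. \<forall>g\<in>G. \<phi> g = sgn (g w)}) ` (\<Pi>\<^sub>E g\<in>G. {-1, 0, 1 :: real}))"
      using G(1) by (intro finite_imageI finite_PiE) auto
  qed
  moreover have "S = \<Union> (?cell ` S)"
  proof
    show "S \<subseteq> \<Union> (?cell ` S)" by (auto simp: same_signs_def)
    show "\<Union> (?cell ` S) \<subseteq> S" using G(3) by (auto simp: saturated_def)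
  qed
  ultimately show "semialgebraic S" unfolding semialgebraic_def by blast
qed

section \<open>Boolean operations, polynomial preimages and quantifiers\<close>

lemma semialgebraic_not: "semialgebraic {x. P x} \<Longrightarrow> semialgebraic {x. \<not> P x}"
  using same_signs_sym unfolding semialgebraic_iff_saturated saturated_def by (metis mem_Collect_eq)

lemma semialgebraic_Union:
  assumes "finite I" "\<And>i. i \<in> I \<Longrightarrow> semialgebraic (S i)"
  shows "semialgebraic (\<Union>i\<in>I. S i)"
proof -
  obtain G where G: "finite G" "G \<subseteq> polyfuns Basis" "\<forall>i\<in>I. saturated G (S i)"
    using finite_saturated[of I "polyfuns Basis" S] assms unfolding semialgebraic_iff_saturated by blast
  then have "saturated G (\<Union>i\<in>I. S i)" unfolding saturated_def by blast
  then show ?thesis unfolding semialgebraic_iff_saturated using G by blast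
qed

lemma semialgebraic_disj:
  assumes "semialgebraic {x. P x}" "semialgebraic {x. Q x}"
  shows "semialgebraic {x. P x \<or> Q x}"
proof -
  have "{x. P x \<or> Q x} = (\<Union>b::bool\<in>UNIV. if b then {x. P x} else {x. Q x})" by (auto split: if_splits)
  also have "semialgebraic \<dots>" by (rule semialgebraic_Union) (use assms in auto)
  finally show ?thesis .
qed

lemma semialgebraic_conj:
  assumes "semialgebraic {x. P x}" "semialgebraic {x. Q x}"
  shows "semialgebraic {x. P x \<and> Q x}"
  using semialgebraic_not[OF semialgebraic_disj[OF semialgebraic_not[OF assms(1)] semialgebraic_not[OF assms(2)]]]
  by simp

lemma semialgebraic_imp:
  assumes "semialgebraic {x. P x}" "semialgebraic {x. Q x}"
  shows "semialgebraic {x. P x \<longrightarrow> Q x}"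
  unfolding imp_conv_disj by (intro semialgebraic_disj semialgebraic_not assms)

lemma semialgebraic_preimage:
  assumes "semialgebraic S" "polynomial_function h"
  shows "semialgebraic {x. h x \<in> S}"
proof -
  obtain G where G: "finite G" "G \<subseteq> polyfuns Basis" "saturated G S"
    using assms(1) unfolding semialgebraic_iff_saturated by blast
  have "saturated ((\<lambda>g. g \<circ> h) ` G) {x. h x \<in> S}"
    using G(3) by (auto simp: saturated_def same_signs_def)
  moreover have "(\<lambda>g. g \<circ> h) ` G \<subseteq> polyfuns Basis"
    using G(2) assms(2) unfolding polyfuns_Basis by (auto intro: real_polynomial_function_compose)
  ultimately show ?thesis unfolding semialgebraic_iff_saturated using G(1) by blast
qed

lemma semialgebraic_positive:
  assumes "real_polynomial_function p"
  shows "semialgebraic {x. p x > 0}"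
proof -
  have "saturated {p} {x. p x > 0}" by (auto simp: saturated_def same_signs_def sgn_1_pos)
  then show ?thesis unfolding semialgebraic_iff_saturated polyfuns_Basis using assms by blast
qed

text \<open>Instead of being projected, the set is swept along \<open>b\<close>, which keeps the
  ambient space. Once the coordinate \<open>b\<close> is split off, the quantifier over
  \<open>t\<close> asks whether a sign vector is realised, and this is decided by polynomials in the
  other coordinates.\<close>

lemma semialgebraic_exists_direction:
  fixes S :: "'a::euclidean_space set"
  assumes "semialgebraic S" and b: "b \<in> Basis"
  shows "semialgebraic {z. \<exists>t. z + t *\<^sub>R b \<in> S}"
proof -
  define B where "B = Basis - {b}"
  have B: "insert b B = Basis" "B \<subseteq> Basis" "b \<notin> B" using b by (auto simp: B_def)
  obtain G where G: "finite G" "G \<subseteq> polyfuns (insert b B)" "saturated G S"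
    using assms(1) unfolding semialgebraic_iff_saturated B(1) by blast
  obtain d F where F: "finite F" "F \<subseteq> poly_ring.param_polys B d" "G = eval_along b ` F"
    using finite_polyfuns_insert_representation[OF G(1,2)] by blast
  obtain H where H: "finite H" "H \<subseteq> polyfuns B"
    "\<And>x x' t. same_signs H x x' \<Longrightarrow> \<exists>t'. poly_signs F x t x' t'"
    using poly_ring.decided_finite[OF F(1,2)] unfolding poly_ring.decided_def
    by (elim exE conjE) (rule that, assumption+, simp)
  have ev: "eval_along b P (z + t *\<^sub>R b) = poly (P z) (z \<bullet> b + t)" if "P \<in> F" for P z t
    using param_polys_invariant[of P B d b z t] that F(2) B b
    by (auto simp: eval_along_def inner_add_left)
  have "saturated H {z. \<exists>t. z + t *\<^sub>R b \<in> S}"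
    unfolding saturated_def
  proof (intro allI impI CollectI)
    fix z w assume zw: "same_signs H z w" and "z \<in> {z. \<exists>t. z + t *\<^sub>R b \<in> S}"
    then obtain t where t: "z + t *\<^sub>R b \<in> S" by blast
    obtain s where s: "poly_signs F z (z \<bullet> b + t) w s" using H(3)[OF zw] by blast
    have "sgn (eval_along b P (z + t *\<^sub>R b)) = sgn (eval_along b P (w + (s - w \<bullet> b) *\<^sub>R b))"
      if "P \<in> F" for P
      using s that by (simp add: ev poly_signs_def)
    then have "same_signs G (z + t *\<^sub>R b) (w + (s - w \<bullet> b) *\<^sub>R b)"
      by (simp add: same_signs_def F(3))
    then show "\<exists>t. w + t *\<^sub>R b \<in> S" using t G(3) unfolding saturated_def by blast
  qed
  moreover have "H \<subseteq> polyfuns Basis" using H(2) polyfuns_mono[OF B(2)] by blast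
  ultimately show ?thesis unfolding semialgebraic_iff_saturated using H(1) by blast
qed

text \<open>The coordinates of \<open>y\<close> are quantified one at a time by sweeping inside the
  product space. Restricting the result to second component 0 then recovers the claim, since every
  \<open>y\<close> is reached from 0 by such translations.\<close>

theorem semialgebraic_Ex:
  fixes P :: "'a::euclidean_space \<Rightarrow> 'b::euclidean_space \<Rightarrow> bool"
  assumes "semialgebraic {q. P (fst q) (snd q)}"
  shows "semialgebraic {x. \<exists>y. P x y}"
proof -
  let ?S = "{q. P (fst q) (snd q)}"
  have "semialgebraic {z. \<exists>c. z + (0, \<Sum>d\<in>D. c d *\<^sub>R d) \<in> ?S}"
    if "finite D" "D \<subseteq> (Basis :: 'b set)" for D
    using that
  proof (induction D rule: finite_induct)
    case empty
    then show ?case using assms by (simp add: zero_prod_def[symmetric])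
  next
    case (insert d D)
    have "(0, d) \<in> (Basis :: ('a \<times> 'b) set)" using insert.prems by (simp add: Basis_prod_def)
    moreover have "semialgebraic {z. \<exists>c. z + (0, \<Sum>d\<in>D. c d *\<^sub>R d) \<in> ?S}" using insert by simp
    ultimately have "semialgebraic {z. \<exists>t. z + t *\<^sub>R (0, d) \<in> {z. \<exists>c. z + (0, \<Sum>d\<in>D. c d *\<^sub>R d) \<in> ?S}}"
      by (intro semialgebraic_exists_direction)
    also have "{z. \<exists>t. z + t *\<^sub>R (0, d) \<in> {z. \<exists>c. z + (0, \<Sum>d\<in>D. c d *\<^sub>R d) \<in> ?S}} =
      {z. \<exists>c. z + (0, \<Sum>d\<in>insert d D. c d *\<^sub>R d) \<in> ?S}" (is "?L = ?R")
    proof (intro set_eqI iffI)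
      fix z assume "z \<in> ?L"
      then obtain t c where c: "z + t *\<^sub>R (0, d) + (0, \<Sum>d\<in>D. c d *\<^sub>R d) \<in> ?S" by blast
      have "(\<Sum>e\<in>D. (c(d := t)) e *\<^sub>R e) = (\<Sum>e\<in>D. c e *\<^sub>R e)"
        by (rule sum.cong) (use insert.hyps in auto)
      then have "z + (0, \<Sum>e\<in>insert d D. (c(d := t)) e *\<^sub>R e) = z + t *\<^sub>R (0, d) + (0, \<Sum>d\<in>D. c d *\<^sub>R d)"
        using insert.hyps by (simp add: add.assoc)
      then show "z \<in> ?R" using c by (intro CollectI exI[of _ "c(d := t)"]) (simp add: add.assoc)
    next
      fix z assume "z \<in> ?R"
      then obtain c where c: "z + (0, \<Sum>d\<in>insert d D. c d *\<^sub>R d) \<in> ?S" by blast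
      moreover have "z + (0, \<Sum>e\<in>insert d D. c e *\<^sub>R e) = z + c d *\<^sub>R (0, d) + (0, \<Sum>d\<in>D. c d *\<^sub>R d)"
        using insert.hyps by (simp add: add.assoc)
      ultimately have "z + c d *\<^sub>R (0, d) + (0, \<Sum>d\<in>D. c d *\<^sub>R d) \<in> ?S" by metis
      then show "z \<in> ?L" by blast
    qed
    finally show ?case .
  qed
  from this[of Basis] have "semialgebraic {z. \<exists>c. z + (0, \<Sum>d\<in>Basis. c d *\<^sub>R d) \<in> ?S}" by simp
  then have "semialgebraic {x. (x, 0) \<in> {z. \<exists>c. z + (0, \<Sum>d\<in>Basis. c d *\<^sub>R d) \<in> ?S}}"
    by (rule semialgebraic_preimage)
       (intro polynomial_function_bounded_linear bounded_linear_Pair bounded_linear_ident bounded_linear_zero)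
  moreover have "(\<exists>c. P x (\<Sum>d\<in>Basis. c d *\<^sub>R d)) \<longleftrightarrow> (\<exists>y. P x y)" for x
    by (metis euclidean_representation)
  ultimately show ?thesis by simp
qed

lemma semialgebraic_All:
  fixes P :: "'a::euclidean_space \<Rightarrow> 'b::euclidean_space \<Rightarrow> bool"
  assumes "semialgebraic {q. P (fst q) (snd q)}"
  shows "semialgebraic {x. \<forall>y. P x y}"
  using semialgebraic_not[OF semialgebraic_Ex[OF semialgebraic_not[OF assms]]] by simp

section \<open>Countable semialgebraic sets are finite\<close>

lemma countable_semialgebraic_real_finite:
  fixes T :: "real set"
  assumes "semialgebraic T" "countable T"
  shows "finite T"
proof -
  obtain G where G: "finite G" "G \<subseteq> polyfuns (Basis :: real set)" "saturated G T"
    using assms(1) unfolding semialgebraic_iff_saturated by blast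
  have poly: "\<exists>p. g = poly p" if g: "g \<in> G" for g
  proof -
    have "g \<in> polyfuns (insert 1 {})" using g G(2) by (auto simp: Basis_real_def)
    then obtain d P where P: "P \<in> poly_ring.param_polys {} d" "g = eval_along 1 P"
      using polyfuns_insert_representation by blast
    \<comment> \<open>No coordinate is left for the coefficients to depend on, so \<open>P\<close>
      is one ordinary polynomial.\<close>
    have "P z = P 0" for z
    proof (rule poly_eqI)
      fix i
      have "(\<lambda>z. coeff (P z) i) \<in> polyfuns {}" using P(1) by (auto simp: poly_ring.param_polys_def)
      then show "coeff (P z) i = coeff (P 0) i" by (rule polyfuns_empty)
    qed
    then have "g = poly (P 0)" using P(2) by (auto simp: eval_along_def fun_eq_iff) metis
    then show ?thesis by blast
  qed
  define Z where "Z = (\<Union>g\<in>{g\<in>G. g \<noteq> (\<lambda>_. 0)}. {t. g t = 0})"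
  have "finite {t. g t = 0}" if "g \<in> G" "g \<noteq> (\<lambda>_. 0)" for g
  proof -
    obtain p where "g = poly p" using poly[OF \<open>g \<in> G\<close>] by blast
    then show ?thesis using \<open>g \<noteq> (\<lambda>_. 0)\<close> poly_roots_finite[of p] by fastforce
  qed
  then have "finite Z" using G(1) by (auto simp: Z_def)
  moreover have "T \<subseteq> Z"
  proof
    \<comment> \<open>Away from the zeros of the nonzero members all signs are locally constant, so
      a point of \<open>T\<close> there would bring a whole ball into \<open>T\<close>, which is
      uncountable.\<close>
    fix t assume t: "t \<in> T"
    show "t \<in> Z"
    proof (rule ccontr)
      assume "t \<notin> Z"
      have "\<forall>\<^sub>F s in nhds t. \<forall>g\<in>G. sgn (g s) = sgn (g t)"
      proof (rule eventually_ball_finite[OF G(1)], rule ballI)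
        fix g assume g: "g \<in> G"
        show "\<forall>\<^sub>F s in nhds t. sgn (g s) = sgn (g t)"
        proof (cases "g = (\<lambda>_. 0)")
          case False
          then have "g t \<noteq> 0" using \<open>t \<notin> Z\<close> g by (auto simp: Z_def)
          moreover have "(g \<longlongrightarrow> g t) (nhds t)"
            using poly[OF g] poly_isCont unfolding isCont_def tendsto_at_iff_tendsto_nhds by metis
          ultimately show ?thesis by (intro sgn_tendsto_nonzero)
        qed simp
      qed
      then obtain e where e: "e > 0" "\<And>s g. dist s t < e \<Longrightarrow> g \<in> G \<Longrightarrow> sgn (g s) = sgn (g t)"
        unfolding eventually_nhds_metric by blast
      have "ball t e \<subseteq> T"
      proof
        fix s assume "s \<in> ball t e"
        then have "same_signs G t s" using e(2)[of s] by (simp add: same_signs_def dist_commute)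
        then show "s \<in> T" using t G(3) by (auto simp: saturated_def)
      qed
      then have "countable (ball t e)" using assms(2) countable_subset by blast
      then show False using e(1) uncountable_ball by blast
    qed
  qed
  ultimately show ?thesis by (rule finite_subset[rotated])
qed

lemma semialgebraic_snd:
  fixes S :: "('a::euclidean_space \<times> 'b::euclidean_space) set"
  assumes "semialgebraic S"
  shows "semialgebraic (snd ` S)"
proof -
  have "semialgebraic {q :: 'b \<times> 'a. (snd q, fst q) \<in> S}"
    by (rule semialgebraic_preimage[OF assms])
       (intro polynomial_function_bounded_linear bounded_linear_Pair bounded_linear_fst bounded_linear_snd)
  then have "semialgebraic {y. \<exists>x. (x, y) \<in> S}" by (rule semialgebraic_Ex)
  moreover have "{y. \<exists>x. (x, y) \<in> S} = snd ` S" by force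
  ultimately show ?thesis by simp
qed

text \<open>Each coordinate projection is a countable semialgebraic subset of the line, hence
  finite, and \<open>S\<close> lies in the finite grid that these projections span.\<close>

lemma countable_semialgebraic_finite:
  fixes S :: "'a::euclidean_space set"
  assumes "semialgebraic S" "countable S"
  shows "finite S"
proof -
  have "finite ((\<lambda>x. x \<bullet> b) ` S)" for b
  proof (rule countable_semialgebraic_real_finite)
    have "semialgebraic {q :: 'a \<times> real. fst q \<in> S}"
      by (rule semialgebraic_preimage[OF assms(1) polynomial_function_bounded_linear[OF bounded_linear_fst]])
    moreover have "polynomial_function (\<lambda>q :: 'a \<times> real. snd q - fst q \<bullet> b)"
      by (intro polynomial_function_bounded_linear bounded_linear_sub bounded_linear_snd
          bounded_linear_compose[OF bounded_linear_inner_left bounded_linear_fst])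
    \<comment> \<open>Equality is expressed by a square that is not positive, which reduces it to
      \<open>semialgebraic_positive\<close>.\<close>
    then have "semialgebraic {q :: 'a \<times> real. \<not> (snd q - fst q \<bullet> b) ^ 2 > 0}"
      by (intro semialgebraic_not semialgebraic_positive real_polynomial_function_power)
         (simp only: real_polynomial_function_eq)
    ultimately have "semialgebraic {q :: 'a \<times> real. fst q \<in> S \<and> \<not> (snd q - fst q \<bullet> b) ^ 2 > 0}"
      by (rule semialgebraic_conj)
    from semialgebraic_snd[OF this]
    show "semialgebraic ((\<lambda>x. x \<bullet> b) ` S)"
      by (rule back_subst[of semialgebraic]) (auto simp: image_iff Bex_def)
    show "countable ((\<lambda>x. x \<bullet> b) ` S)" using assms(2) by simp
  qed
  then have "finite (\<Pi>\<^sub>E b\<in>Basis. (\<lambda>x. x \<bullet> b) ` S)" by (intro finite_PiE) auto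
  moreover have "S \<subseteq> (\<lambda>\<phi>. \<Sum>b\<in>Basis. \<phi> b *\<^sub>R b) ` (\<Pi>\<^sub>E b\<in>Basis. (\<lambda>x. x \<bullet> b) ` S)"
  proof
    fix x assume "x \<in> S"
    then have "restrict (\<lambda>b. x \<bullet> b) Basis \<in> (\<Pi>\<^sub>E b\<in>Basis. (\<lambda>x. x \<bullet> b) ` S)" by auto
    moreover have "x = (\<Sum>b\<in>Basis. restrict (\<lambda>b. x \<bullet> b) Basis b *\<^sub>R b)"
      by (simp add: euclidean_representation)
    ultimately show "x \<in> (\<lambda>\<phi>. \<Sum>b\<in>Basis. \<phi> b *\<^sub>R b) ` (\<Pi>\<^sub>E b\<in>Basis. (\<lambda>x. x \<bullet> b) ` S)" by blast
  qed
  ultimately show ?thesis by (meson finite_imageI finite_subset)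
qed

section \<open>Local minimizers\<close>

text \<open>Strict and non-strict minimizers are two choices of \<open>Q\<close>. Norms are compared
  through their squares, which are polynomials; this is legitimate because the radius, carried along
  as an extra real coordinate, is positive.\<close>

lemma semialgebraic_locally:
  fixes X :: "'a::euclidean_space set"
  assumes X: "semialgebraic X" and Q: "semialgebraic {p. Q (fst p) (snd p)}"
  shows "semialgebraic {x. x \<in> X \<and>
    (\<exists>\<delta>>0. \<forall>y\<in>X. 0 < norm (y - x) \<and> norm (y - x) < \<delta> \<longrightarrow> Q x y)}"
proof -
  have coord: "polynomial_function (\<lambda>p :: ('a \<times> real) \<times> 'a. fst (fst p))"
    "polynomial_function (\<lambda>p :: ('a \<times> real) \<times> 'a. snd (fst p))"
    "polynomial_function (\<lambda>p :: ('a \<times> real) \<times> 'a. snd p)"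
    by (intro polynomial_function_bounded_linear bounded_linear_snd
        bounded_linear_fst_comp bounded_linear_snd_comp bounded_linear_fst)+
  have sq: "real_polynomial_function (\<lambda>p :: ('a \<times> real) \<times> 'a. (snd p - fst (fst p)) \<bullet> (snd p - fst (fst p)))"
  proof -
    have "real_polynomial_function (\<lambda>p :: ('a \<times> real) \<times> 'a. (snd p - fst (fst p)) \<bullet> b)" for b :: 'a
      unfolding real_polynomial_function_eq
      by (intro polynomial_function_bounded_linear bounded_linear_snd bounded_linear_sub
        bounded_linear_compose[OF bounded_linear_inner_left] bounded_linear_fst_comp bounded_linear_fst)
    then show ?thesis
      by (subst euclidean_inner) (intro real_polynomial_function_sum real_polynomial_function.intros(4) finite_Basis)
  qed
  have "semialgebraic {p :: ('a \<times> real) \<times> 'a. snd p \<in> X}"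
    by (rule semialgebraic_preimage[OF X coord(3)])
  moreover have "semialgebraic {p :: ('a \<times> real) \<times> 'a. 0 < (snd p - fst (fst p)) \<bullet> (snd p - fst (fst p))}"
    by (rule semialgebraic_positive[OF sq])
  moreover have "semialgebraic {p :: ('a \<times> real) \<times> 'a.
      0 < snd (fst p) ^ 2 - (snd p - fst (fst p)) \<bullet> (snd p - fst (fst p))}"
    using coord(2) sq by (intro semialgebraic_positive) (auto simp: real_polynomial_function_eq[symmetric])
  moreover have "semialgebraic {p :: ('a \<times> real) \<times> 'a. Q (fst (fst p)) (snd p)}"
    using semialgebraic_preimage[OF Q, of "\<lambda>p :: ('a \<times> real) \<times> 'a. (fst (fst p), snd p)"]
    by (simp add: polynomial_function_bounded_linear bounded_linear_Pair bounded_linear_fst_comp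
        bounded_linear_fst bounded_linear_snd)
  ultimately have "semialgebraic {p :: ('a \<times> real) \<times> 'a. snd p \<in> X \<longrightarrow>
      0 < (snd p - fst (fst p)) \<bullet> (snd p - fst (fst p)) \<longrightarrow>
      0 < snd (fst p) ^ 2 - (snd p - fst (fst p)) \<bullet> (snd p - fst (fst p)) \<longrightarrow> Q (fst (fst p)) (snd p)}"
    by (intro semialgebraic_imp)
  then have "semialgebraic {q :: 'a \<times> real. \<forall>y. y \<in> X \<longrightarrow> 0 < (y - fst q) \<bullet> (y - fst q) \<longrightarrow>
      0 < snd q ^ 2 - (y - fst q) \<bullet> (y - fst q) \<longrightarrow> Q (fst q) y}"
    by (rule semialgebraic_All)
  moreover have "semialgebraic {q :: 'a \<times> real. snd q > 0}"
    using polynomial_function_bounded_linear[OF bounded_linear_snd]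
    by (intro semialgebraic_positive) (simp add: real_polynomial_function_eq)
  ultimately have "semialgebraic {q :: 'a \<times> real. snd q > 0 \<and> (\<forall>y. y \<in> X \<longrightarrow> 0 < (y - fst q) \<bullet> (y - fst q) \<longrightarrow>
      0 < snd q ^ 2 - (y - fst q) \<bullet> (y - fst q) \<longrightarrow> Q (fst q) y)}"
    by (intro semialgebraic_conj)
  then have "semialgebraic {x. \<exists>\<delta>. \<delta> > 0 \<and> (\<forall>y. y \<in> X \<longrightarrow> 0 < (y - x) \<bullet> (y - x) \<longrightarrow>
      0 < \<delta> ^ 2 - (y - x) \<bullet> (y - x) \<longrightarrow> Q x y)}"
    by (rule semialgebraic_Ex)
  then have "semialgebraic {x. x \<in> X \<and> (\<exists>\<delta>. \<delta> > 0 \<and> (\<forall>y. y \<in> X \<longrightarrow> 0 < (y - x) \<bullet> (y - x) \<longrightarrow>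
      0 < \<delta> ^ 2 - (y - x) \<bullet> (y - x) \<longrightarrow> Q x y))}"
    using X by (intro semialgebraic_conj) simp_all
  moreover have "norm (y - x) < \<delta> \<longleftrightarrow> 0 < \<delta> ^ 2 - (y - x) \<bullet> (y - x)" if "\<delta> > 0" for x y :: 'a and \<delta>
    using that by (simp add: dot_square_norm abs_le_square_iff flip: not_le)
  then have "(x \<in> X \<and> (\<exists>\<delta>. \<delta> > 0 \<and> (\<forall>y. y \<in> X \<longrightarrow> 0 < (y - x) \<bullet> (y - x) \<longrightarrow>
      0 < \<delta> ^ 2 - (y - x) \<bullet> (y - x) \<longrightarrow> Q x y))) \<longleftrightarrow>
      x \<in> X \<and> (\<exists>\<delta>>0. \<forall>y\<in>X. 0 < norm (y - x) \<and> norm (y - x) < \<delta> \<longrightarrow> Q x y)" for x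
    by (smt (verit, ccfv_threshold) inner_gt_zero_iff zero_less_norm_iff)
  ultimately show ?thesis by simp
qed

text \<open>\<open>f\<close> need not be a polynomial, so its two values become quantified variables
  tied to the graph.\<close>

lemma semialgebraic_compare_values:
  fixes X :: "'a::euclidean_space set" and f :: "'a \<Rightarrow> real"
  assumes f: "semialgebraic {(x, f x) |x. x \<in> X}"
  shows "semialgebraic {p. fst p \<in> X \<and> snd p \<in> X \<and> f (fst p) < f (snd p)}"
proof -
  let ?Gr = "{(x, f x) |x. x \<in> X}"
  have 1: "semialgebraic {p :: (('a \<times> 'a) \<times> real) \<times> real. (fst (fst (fst p)), snd (fst p)) \<in> ?Gr}"
    by (rule semialgebraic_preimage[OF f])
       (intro polynomial_function_bounded_linear bounded_linear_Pair bounded_linear_fst_comp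
         bounded_linear_snd_comp bounded_linear_fst)
  have 2: "semialgebraic {p :: (('a \<times> 'a) \<times> real) \<times> real. (snd (fst (fst p)), snd p) \<in> ?Gr}"
    by (rule semialgebraic_preimage[OF f])
       (intro polynomial_function_bounded_linear bounded_linear_Pair bounded_linear_fst_comp
         bounded_linear_snd_comp bounded_linear_fst bounded_linear_snd)
  have 3: "semialgebraic {p :: (('a \<times> 'a) \<times> real) \<times> real. 0 < snd p - snd (fst p)}"
    by (rule semialgebraic_positive, unfold real_polynomial_function_eq)
       (intro polynomial_function_bounded_linear bounded_linear_sub bounded_linear_snd_comp
         bounded_linear_fst bounded_linear_snd)
  have "semialgebraic {q :: ('a \<times> 'a) \<times> real. \<exists>v. (fst (fst q), snd q) \<in> ?Gr \<and>
      (snd (fst q), v) \<in> ?Gr \<and> 0 < v - snd q}"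
    by (rule semialgebraic_Ex) (intro semialgebraic_conj 1 2 3)
  then have "semialgebraic {p. \<exists>u v. (fst p, u) \<in> ?Gr \<and> (snd p, v) \<in> ?Gr \<and> 0 < v - u}"
    by (rule semialgebraic_Ex)
  then show ?thesis by (rule back_subst[of semialgebraic]) auto
qed

lemma semialgebraic_local_minimizers:
  fixes X :: "'a::euclidean_space set"
  assumes X: "semialgebraic X" and f: "semialgebraic {(x, f x) |x. x \<in> X}"
  shows "semialgebraic {x. local_minimizer X f x}" "semialgebraic {x. strictly_local_minimizer X f x}"
proof -
  note less = semialgebraic_compare_values[OF f]
  \<comment> \<open>The non-strict comparison is the negation of the strict one with exchanged
    arguments. It also holds at pairs outside \<open>X\<close>, which is harmless because both
    points are restricted to \<open>X\<close> later.\<close>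
  have less': "semialgebraic {p. \<not> (snd p \<in> X \<and> fst p \<in> X \<and> f (snd p) < f (fst p))}"
  proof (rule semialgebraic_not)
    have "polynomial_function (\<lambda>p :: 'a \<times> 'a. (snd p, fst p))"
      by (intro polynomial_function_bounded_linear bounded_linear_Pair bounded_linear_fst bounded_linear_snd)
    from semialgebraic_preimage[OF less this]
    show "semialgebraic {p. snd p \<in> X \<and> fst p \<in> X \<and> f (snd p) < f (fst p)}" by simp
  qed
  show "semialgebraic {x. strictly_local_minimizer X f x}"
    using semialgebraic_locally[OF X less] unfolding strictly_local_minimizer_def
    by (rule back_subst[of semialgebraic]) blast
  show "semialgebraic {x. local_minimizer X f x}"
    using semialgebraic_locally[OF X less'] unfolding local_minimizer_def
    by (rule back_subst[of semialgebraic]) (auto simp: not_less; blast)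
qed

section \<open>Continuous selections are semialgebraic\<close>

lemma semialgebraic_selection:
  fixes X :: "'a::euclidean_space set"
  assumes X: "semialgebraic X"
    and cont: "\<And>i. i \<in> {1..r} \<Longrightarrow> continuous_on X (fs i)"
    and sa: "\<And>i. i \<in> {1..r} \<Longrightarrow> semialgebraic_fun_on X (fs i)"
    and f: "f \<in> continuous_selections fs r X"
  shows "semialgebraic {(x, f x) |x. x \<in> X}"
proof -
  have contf: "continuous_on X f" and sel: "\<And>x. x \<in> X \<Longrightarrow> \<exists>i\<in>{1..r}. f x = fs i x"
    using f unfolding continuous_selections_def by blast+
  define E where "E = (\<lambda>(i, j). {x \<in> X. fs i x = fs j x})"
  have Gr: "semialgebraic {(x, fs i x) |x. x \<in> X}" if "i \<in> {1..r}" for i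
    using sa[OF that] by (simp add: semialgebraic_fun_on_def)
  have "semialgebraic (E ij)" if "ij \<in> {1..r} \<times> {1..r}" for ij
  proof -
    obtain i j where ij: "ij = (i, j)" "i \<in> {1..r}" "j \<in> {1..r}" using \<open>ij \<in> _\<close> by blast
    have "semialgebraic {q. (fst q, snd q) \<in> {(x, fs i x) |x. x \<in> X} \<and>
        (fst q, snd q) \<in> {(x, fs j x) |x. x \<in> X}}"
      using semialgebraic_conj[of "\<lambda>q. q \<in> {(x, fs i x) |x. x \<in> X}" "\<lambda>q. q \<in> {(x, fs j x) |x. x \<in> X}"]
        Gr ij(2,3) by simp
    from semialgebraic_Ex[OF this] show ?thesis
      by (rule back_subst[of semialgebraic]) (auto simp: E_def ij(1))
  qed
  then obtain G1 where G1: "finite G1" "G1 \<subseteq> polyfuns Basis"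
      "\<forall>ij\<in>{1..r} \<times> {1..r}. saturated G1 (E ij)"
    using finite_saturated[of "{1..r} \<times> {1..r}" "polyfuns Basis" E]
    unfolding semialgebraic_iff_saturated by blast
  obtain G2 where G2: "finite G2" "G2 \<subseteq> polyfuns Basis" "saturated G2 X"
    using X unfolding semialgebraic_iff_saturated by blast
  obtain G where G: "finite G" "G1 \<union> G2 \<subseteq> G" "G \<subseteq> polyfuns Basis"
      "\<And>z. connected {w. same_signs G z w}"
    using connected_sign_cells[of Basis "G1 \<union> G2"] G1 G2 by auto
  have satX: "saturated G X" using saturated_mono[OF G2(3)] G(2) by blast
  have satE: "saturated G (E (i, j))" if "i \<in> {1..r}" "j \<in> {1..r}" for i j
    using saturated_mono[of G1 _ G] G1(3) G(2) that by blast
  have sat: "saturated G {x\<in>X. f x = fs i x}" if i: "i \<in> {1..r}" for i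
    unfolding saturated_def
  proof (intro allI impI)
    fix z w assume zw: "same_signs G z w" and "z \<in> {x\<in>X. f x = fs i x}"
    then have z: "z \<in> X" "f z = fs i z" by auto
    define C where "C = {w. same_signs G z w}"
    have CX: "C \<subseteq> X" using z(1) satX by (auto simp: C_def saturated_def)
    define agree where "agree j = {x\<in>C. f x = fs j x}" for j
    \<comment> \<open>By saturation of the sets \<open>E\<close>, an index in \<open>J\<close> gives
      a function different from \<open>fs i\<close> on all of \<open>C\<close>, and any other index
      gives one equal to \<open>fs i\<close> there. So \<open>agree i\<close> and the union over
      \<open>J\<close> are disjoint closed sets covering \<open>C\<close>, and the one without
      \<open>z\<close> must be empty.\<close>
    define J where "J = {j\<in>{1..r}. fs j z \<noteq> fs i z}"
    have closed: "closedin (top_of_set C) (agree j)" if "j \<in> {1..r}" for j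
    proof -
      have "continuous_on C (\<lambda>x. f x - fs j x)"
        using contf cont[OF that] CX by (intro continuous_intros) (auto intro: continuous_on_subset)
      from continuous_closedin_preimage_constant[OF this, of 0] show ?thesis by (simp add: agree_def)
    qed
    have "closedin (top_of_set C) (\<Union>j\<in>J. agree j)"
      by (intro closedin_Union) (auto simp: J_def intro: closed)
    moreover have cover: "C \<subseteq> agree i \<union> (\<Union>j\<in>J. agree j)"
    proof
      fix x assume x: "x \<in> C"
      then obtain j where j: "j \<in> {1..r}" "f x = fs j x" using sel CX by blast
      show "x \<in> agree i \<union> (\<Union>j\<in>J. agree j)"
      proof (cases "fs j z = fs i z")
        case True
        then have "z \<in> E (i, j)" using z by (auto simp: E_def)
        then have "x \<in> E (i, j)" using satE[OF i j(1)] x by (auto simp: saturated_def C_def)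
        then show ?thesis using j x by (auto simp: E_def agree_def)
      qed (use j x in \<open>auto simp: J_def agree_def\<close>)
    qed
    moreover have "agree i \<inter> (\<Union>j\<in>J. agree j) = {}"
    proof (rule ccontr)
      assume "agree i \<inter> (\<Union>j\<in>J. agree j) \<noteq> {}"
      then obtain x j where x: "x \<in> agree i" "j \<in> J" "x \<in> agree j" by blast
      then have "x \<in> E (i, j)" using CX by (auto simp: E_def agree_def)
      moreover have "same_signs G x z" using x(1) by (auto simp: agree_def C_def intro: same_signs_sym)
      ultimately have "z \<in> E (i, j)" using satE[OF i] x(2) by (auto simp: saturated_def J_def)
      then show False using x(2) by (auto simp: E_def J_def)
    qed
    moreover have "z \<in> agree i" using z by (auto simp: agree_def C_def same_signs_def)
    moreover have "connected C" using G(4) by (simp add: C_def)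
    ultimately have "(\<Union>j\<in>J. agree j) = {}"
      using closed[OF i] unfolding connected_closedin by blast
    then have "w \<in> agree i" using cover zw by (auto simp: C_def)
    then show "w \<in> {x\<in>X. f x = fs i x}" using CX by (auto simp: agree_def)
  qed
  have "semialgebraic {q. q \<in> {(x, fs i x) |x. x \<in> X} \<and> fst q \<in> {x\<in>X. f x = fs i x}}"
    if i: "i \<in> {1..r}" for i
  proof (rule semialgebraic_conj)
    have "semialgebraic {x\<in>X. f x = fs i x}"
      unfolding semialgebraic_iff_saturated using sat[OF i] G(1,3) by blast
    from semialgebraic_preimage[OF this polynomial_function_bounded_linear[OF bounded_linear_fst]]
    show "semialgebraic {q :: 'a \<times> real. fst q \<in> {x\<in>X. f x = fs i x}}" .
  qed (use Gr[OF i] in simp)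
  then have "semialgebraic (\<Union>i\<in>{1..r}. {q. q \<in> {(x, fs i x) |x. x \<in> X} \<and> fst q \<in> {x\<in>X. f x = fs i x}})"
    by (intro semialgebraic_Union) auto
  also have "(\<Union>i\<in>{1..r}. {q. q \<in> {(x, fs i x) |x. x \<in> X} \<and> fst q \<in> {x\<in>X. f x = fs i x}}) =
      {(x, f x) |x. x \<in> X}"
  proof
    show "{(x, f x) |x. x \<in> X} \<subseteq>
      (\<Union>i\<in>{1..r}. {q. q \<in> {(x, fs i x) |x. x \<in> X} \<and> fst q \<in> {x\<in>X. f x = fs i x}})"
      using sel by auto
  qed auto
  finally show ?thesis .
qed

section \<open>Countability from a countable base of the topology\<close>

lemma countable_local_minimum_values:
  fixes X :: "'a::euclidean_space set" and f :: "'a \<Rightarrow> real"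
  shows "countable (f ` {x. local_minimizer X f x})"
proof -
  obtain \<B> :: "'a set set" where \<B>: "countable \<B>" "topological_basis \<B>"
    using ex_countable_basis by blast
  \<comment> \<open>A local minimum value is the infimum of \<open>f\<close> over a small enough
    basic open set. For other basic sets \<open>Inf\<close> may be an arbitrary value, which only
    enlarges the countable set on the right.\<close>
  have "f ` {x. local_minimizer X f x} \<subseteq> (\<lambda>B. Inf (f ` (B \<inter> X))) ` \<B>"
  proof clarify
    fix x assume "local_minimizer X f x"
    then obtain \<delta> where x: "x \<in> X" "\<delta> > 0"
      "\<And>y. y \<in> X \<Longrightarrow> 0 < norm (y - x) \<Longrightarrow> norm (y - x) < \<delta> \<Longrightarrow> f x \<le> f y"
      unfolding local_minimizer_def by blast
    obtain B where B: "B \<in> \<B>" "x \<in> B" "B \<subseteq> ball x \<delta>"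
      using topological_basisE[OF \<B>(2) open_ball, of x x \<delta>] x(2) by auto
    have "f x \<le> f y" if "y \<in> B \<inter> X" for y
      using x(3)[of y] that B(3) by (cases "y = x") (auto simp: dist_norm norm_minus_commute)
    then have "Inf (f ` (B \<inter> X)) = f x"
      using x(1) B(2) by (intro cInf_eq_minimum) auto
    then show "f x \<in> (\<lambda>B. Inf (f ` (B \<inter> X))) ` \<B>" using B(1) by force
  qed
  then show ?thesis using \<B>(1) by (meson countable_image countable_subset)
qed

lemma countable_strictly_local_minimizers:
  fixes X :: "'a::euclidean_space set" and f :: "'a \<Rightarrow> real"
  shows "countable {x. strictly_local_minimizer X f x}"
proof -
  obtain \<B> :: "'a set set" where \<B>: "countable \<B>" "topological_basis \<B>"
    using ex_countable_basis by blast
  \<comment> \<open>A strict minimizer is recovered as the unique strict minimum point on a basic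
    open set. Where no such point exists, the value of \<open>THE\<close> is unspecified but still
    one per basic set.\<close>
  define m where "m B = (THE x. x \<in> B \<inter> X \<and> (\<forall>y\<in>B \<inter> X. y \<noteq> x \<longrightarrow> f x < f y))" for B
  have "{x. strictly_local_minimizer X f x} \<subseteq> m ` \<B>"
  proof clarify
    fix x assume "strictly_local_minimizer X f x"
    then obtain \<delta> where x: "x \<in> X" "\<delta> > 0"
      "\<And>y. y \<in> X \<Longrightarrow> 0 < norm (y - x) \<Longrightarrow> norm (y - x) < \<delta> \<Longrightarrow> f x < f y"
      unfolding strictly_local_minimizer_def by blast
    obtain B where B: "B \<in> \<B>" "x \<in> B" "B \<subseteq> ball x \<delta>"
      using topological_basisE[OF \<B>(2) open_ball, of x x \<delta>] x(2) by auto
    have "f x < f y" if "y \<in> B \<inter> X" "y \<noteq> x" for y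
      using x(3)[of y] that B(3) by (auto simp: dist_norm norm_minus_commute)
    then have "m B = x"
      unfolding m_def using x(1) B(2) by (intro the_equality) (blast, metis IntI less_asym)
    then show "x \<in> m ` \<B>" using B(1) by force
  qed
  then show ?thesis using \<B>(1) by (meson countable_image countable_subset)
qed

section \<open>Isolated and strict local minimizers\<close>

lemma isolated_imp_strictly_local_minimizer:
  assumes "isolated_local_minimizer X f x"
  shows "strictly_local_minimizer X f x"
proof -
  obtain \<delta> where x: "x \<in> X" "\<delta> > 0"
    "\<And>y. y \<in> X \<Longrightarrow> 0 < norm (y - x) \<Longrightarrow> norm (y - x) < \<delta> \<Longrightarrow> f x \<le> f y"
    using assms unfolding isolated_local_minimizer_def local_minimizer_def by blast
  obtain U where "open U" "x \<in> U" and U: "\<And>y. y \<in> U \<Longrightarrow> local_minimizer X f y \<Longrightarrow> y = x"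
    using assms unfolding isolated_local_minimizer_def by blast
  then obtain e where e: "e > 0" "ball x e \<subseteq> U" using open_contains_ball by blast
  have "f x < f y" if y: "y \<in> X" "0 < norm (y - x)" "norm (y - x) < min \<delta> e" for y
  proof (rule ccontr)
    assume "\<not> f x < f y"
    then have eq: "f y = f x" using x(3)[of y] y by simp
    \<comment> \<open>A nearby point sharing the minimum value is itself a local minimizer: the
      radius \<open>\<delta> - norm (y - x)\<close> keeps its neighbourhood inside the ball on which
      \<open>f x\<close> is minimal.\<close>
    have "local_minimizer X f y"
      unfolding local_minimizer_def
    proof (intro conjI exI[of _ "\<delta> - norm (y - x)"] ballI impI)
      fix w assume w: "w \<in> X" "0 < norm (w - y) \<and> norm (w - y) < \<delta> - norm (y - x)"
      have "norm (w - x) \<le> norm (w - y) + norm (y - x)" using norm_triangle_ineq[of "w - y" "y - x"] by simp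
      then have "norm (w - x) < \<delta>" using w(2) by simp
      then show "f y \<le> f w" using x(3)[OF w(1)] eq by (cases "w = x") auto
    qed (use y in auto)
    moreover have "y \<in> U" using y(3) e(2) by (auto simp: dist_norm norm_minus_commute)
    ultimately show False using U y(2) by auto
  qed
  then show ?thesis
    unfolding strictly_local_minimizer_def using x(1,2) e(1) by (intro conjI exI[of _ "min \<delta> e"]) auto
qed

lemma strictly_imp_isolated_local_minimizer:
  assumes strict: "strictly_local_minimizer X f x" and cont: "continuous_on X f"
    and fin: "finite (f ` {x. local_minimizer X f x})"
  shows "isolated_local_minimizer X f x"
proof -
  obtain \<delta> where x: "x \<in> X" "\<delta> > 0"
    "\<And>y. y \<in> X \<Longrightarrow> 0 < norm (y - x) \<Longrightarrow> norm (y - x) < \<delta> \<Longrightarrow> f x < f y"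
    using strict unfolding strictly_local_minimizer_def by blast
  define V where "V = f ` {x. local_minimizer X f x} - {f x}"
  have "closed V" using fin unfolding V_def by (intro finite_imp_closed) simp
  then have "open (- V)" by (rule open_Compl)
  moreover have "f x \<in> - V" by (simp add: V_def)
  ultimately obtain A where A: "open A" "x \<in> A" "\<And>y. y \<in> X \<Longrightarrow> y \<in> A \<Longrightarrow> f y \<in> - V"
    using cont x(1) unfolding continuous_on_topological by meson
  then obtain e where "e > 0" "ball x e \<subseteq> A" using open_contains_ball by blast
  then have e: "e > 0" "\<And>y. y \<in> X \<Longrightarrow> dist y x < e \<Longrightarrow> f y \<in> - V"
    using A(3) by (simp_all add: dist_commute subset_iff)
  have "local_minimizer X f x"
    unfolding local_minimizer_def using x by (auto intro: less_imp_le)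
  moreover have "y = x" if "y \<in> ball x (min \<delta> e)" "local_minimizer X f y" for y
  proof (rule ccontr)
    assume "y \<noteq> x"
    have y: "y \<in> X" "dist y x < e" "norm (y - x) < \<delta>"
      using that by (auto simp: local_minimizer_def dist_norm norm_minus_commute)
    then have "f x < f y" using x(3) \<open>y \<noteq> x\<close> by simp
    moreover have "f y \<in> - V" using e(2) y by blast
    ultimately show False using that(2) by (auto simp: V_def)
  qed
  ultimately show ?thesis
    unfolding isolated_local_minimizer_def using x(2) e(1)
    by (intro conjI exI[of _ "ball x (min \<delta> e)"]) auto
qed

theorem theorem3p2:
  fixes X :: "(real ^ 'n) set"
    and fs :: "nat \<Rightarrow> real ^ 'n \<Rightarrow> real"
    and r :: nat
    and f :: "real ^ 'n \<Rightarrow> real"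
  assumes "semialgebraic X"
    and "\<And>i. i \<in> {1..r} \<Longrightarrow> continuous_on X (fs i)"
    and "\<And>i. i \<in> {1..r} \<Longrightarrow> semialgebraic_fun_on X (fs i)"
    and "f \<in> continuous_selections fs r X"
  shows "(semialgebraic {x. local_minimizer X f x} \<and>
          semialgebraic {x. isolated_local_minimizer X f x} \<and>
          semialgebraic {x. strictly_local_minimizer X f x}) \<and>
         ({x. isolated_local_minimizer X f x} = {x. strictly_local_minimizer X f x} \<and>
          finite {x. isolated_local_minimizer X f x} \<and>
          finite {x. strictly_local_minimizer X f x})"
proof -
  let ?L = "{x. local_minimizer X f x}" and ?S = "{x. strictly_local_minimizer X f x}"
  have graph: "semialgebraic {(x, f x) |x. x \<in> X}"
    by (rule semialgebraic_selection[OF assms])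
  note sa = semialgebraic_local_minimizers[OF assms(1) graph]
  have "finite (f ` ?L)"
  proof (rule countable_semialgebraic_real_finite[OF _ countable_local_minimum_values])
    have "semialgebraic {q :: (real ^ 'n) \<times> real. fst q \<in> ?L}"
      by (rule semialgebraic_preimage[OF sa(1) polynomial_function_bounded_linear[OF bounded_linear_fst]])
    then have "semialgebraic {q. q \<in> {(x, f x) |x. x \<in> X} \<and> fst q \<in> ?L}"
      using graph by (intro semialgebraic_conj) simp_all
    from semialgebraic_snd[OF this] show "semialgebraic (f ` ?L)"
      by (rule back_subst[of semialgebraic]) (force simp: local_minimizer_def)
  qed
  moreover have "continuous_on X f" using assms(4) by (simp add: continuous_selections_def)
  \<comment> \<open>This equality avoids quantifying over open neighbourhoods: semialgebraicity and
    finiteness of the isolated minimizers are taken from the strict ones.\<close>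
  ultimately have eq: "{x. isolated_local_minimizer X f x} = ?S"
    using isolated_imp_strictly_local_minimizer strictly_imp_isolated_local_minimizer by blast
  have "finite ?S"
    by (rule countable_semialgebraic_finite[OF sa(2) countable_strictly_local_minimizers])
  then show ?thesis using sa unfolding eq by blast
qed

end
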